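(* Let $\bar\mu>0$ and $\bar\sigma>0$ be constants and let $R(\theta)=\theta+(1-\theta)\bar g(\theta)$ for $\theta\in[0,1]$. The first-order condition for $R$, $$\frac{\bar g(\theta)-\bar g(0)}{\bar g'(\theta)}=1-\theta,$$ is satisfied for some $\theta$ with $0<\theta<1$. The smallest solution is a local maximum of $R$. If $\bar g$ is concave on $[0,1]$, then the solution of the first-order condition is unique.
   Context: $\Phi$ is the standard normal cumulative distribution function. For $\mu,\sigma>0$ the normal censor $W=W(\mu,\sigma)$ is the unique real solution $W$ of $$e^{-\mu}=\Phi(W-\sigma)+e^{\sigma W-\frac12\sigma^2}\Phi(-W).$$ The profit function (for the Cobb-Douglas revenue $f(x)=2\sqrt x$) is $$g(\mu,\sigma)=e^{\sigma^2-\mu}\Phi(W+\sigma)+e^{-\mu-\sigma W+\frac12\sigma^2}\Phi(-W),\qquad W=W(\mu,\sigma).$$ For $\theta>0$ put $\bar g(\theta)=g(\bar\mu\theta,\bar\sigma\sqrt\theta)$, and $\bar g(0)=1$. Solutions of the first-order condition are sought in $0<\theta<1$. *)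

theory Defs
  imports "HOL-Probability.Probability"
begin

definition std_normal_cdf :: "real \<Rightarrow> real" where
  "std_normal_cdf = cdf std_normal_distribution"

text \<open>
  The definite description is meaningful for \<open>\<mu> > 0\<close> and \<open>\<sigma> > 0\<close>. The right-hand side is
  \<open>E (min X c)\<close> with \<open>X = exp (\<sigma> Z - \<sigma>\<^sup>2 / 2)\<close>, \<open>Z\<close> standard normal, and
  \<open>c = exp (\<sigma> w - \<sigma>\<^sup>2 / 2)\<close>; it increases strictly and continuously from 0 to 1 as \<open>w\<close> runs
  through the reals.
\<close>

definition normal_censor :: "real \<Rightarrow> real \<Rightarrow> real" where
  "normal_censor \<mu> \<sigma> =
     (THE w. exp (- \<mu>) =
        std_normal_cdf (w - \<sigma>) + exp (\<sigma> * w - \<sigma>\<^sup>2 / 2) * std_normal_cdf (- w))"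

definition profit :: "real \<Rightarrow> real \<Rightarrow> real" where
  "profit \<mu> \<sigma> =
     (let w = normal_censor \<mu> \<sigma> in
        exp (\<sigma>\<^sup>2 - \<mu>) * std_normal_cdf (w + \<sigma>)
        + exp (- \<mu> - \<sigma> * w + \<sigma>\<^sup>2 / 2) * std_normal_cdf (- w))"

text \<open>Only the values at \<open>\<theta> \<ge> 0\<close> are meaningful.\<close>

definition gbar :: "real \<Rightarrow> real \<Rightarrow> real \<Rightarrow> real" where
  "gbar \<mu> \<sigma> \<theta> = (if \<theta> = 0 then 1 else profit (\<mu> * \<theta>) (\<sigma> * sqrt \<theta>))"

definition R :: "real \<Rightarrow> real \<Rightarrow> real \<Rightarrow> real" where
  "R \<mu> \<sigma> \<theta> = \<theta> + (1 - \<theta>) * gbar \<mu> \<sigma> \<theta>"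

text \<open>
  The first two conjuncts make explicit that the quotient in the first-order condition has to be
  defined, since \<^const>\<open>deriv\<close> and division are total.
\<close>

definition first_order_condition :: "real \<Rightarrow> real \<Rightarrow> real \<Rightarrow> bool" where
  "first_order_condition \<mu> \<sigma> \<theta> \<longleftrightarrow>
     gbar \<mu> \<sigma> differentiable (at \<theta>) \<and> deriv (gbar \<mu> \<sigma>) \<theta> \<noteq> 0 \<and>
     (gbar \<mu> \<sigma> \<theta> - gbar \<mu> \<sigma> 0) / deriv (gbar \<mu> \<sigma>) \<theta> = 1 - \<theta>"

definition local_maximum_on :: "real set \<Rightarrow> (real \<Rightarrow> real) \<Rightarrow> real \<Rightarrow> bool" where
  "local_maximum_on S f x \<longleftrightarrow> x \<in> S \<and> (\<forall>\<^sub>F y in at x within S. f y \<le> f x)"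

end

theory Submission
  imports Defs
begin

text \<open>Let \<open>Z\<close> be standard normal, \<open>X = exp (s Z - s\<^sup>2 / 2)\<close>, \<open>c = exp (s w - s\<^sup>2 / 2)\<close> and
  \<open>Y = min X c\<close>. The equation that defines the censor point \<open>w\<close> for \<open>(\<mu>, s)\<close> says
  \<open>E Y = exp (-\<mu>)\<close>, and then the profit is \<open>E Y * E (1 / Y)\<close>. Hence it exceeds 1, and
  \<open>R \<theta> = 1 + (1 - \<theta>) (gbar \<theta> - 1)\<close> equals 1 at both ends of \<open>[0, 1]\<close> and exceeds 1 in between. Since
  \<open>gbar\<close> is continuous at 0, \<open>R\<close> has an interior maximum, and in the interior the first-order
  condition is \<open>R' = 0\<close> (\<open>first_order_condition_iff\<close>, \<open>ex_interior_maximum\<close>).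

  Existence alone does not make the smallest critical point a maximum: it could be an inflection
  point. What rules this out is that \<open>R'' < 0\<close> at every critical point of \<open>R\<close> in \<open>(0, 1)\<close>. A
  function with this property has at most one critical point (\<open>at_most_one_falling_zero\<close>), so the
  interior maximum is the only one, and all parts of the proposition follow.

  Put \<open>t = s\<^sup>2 = \<sigma>\<^sup>2 \<theta>\<close>, \<open>r = \<mu> / \<sigma>\<^sup>2\<close> and let \<open>u (t)\<close> be the profit minus 1 for the parameters
  \<open>(r t, sqrt t)\<close>. At a critical point \<open>(1 - \<theta>) \<sigma>\<^sup>2 u' = u\<close>, and \<open>R'' < 0\<close> becomes \<open>u u'' < 2 u'\<^sup>2\<close>. So the
  analytic core is that \<open>u u'' < 2 u'\<^sup>2\<close> wherever \<open>u' > 0\<close>; so \<open>1 / u\<close> is convex where \<open>u\<close>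
  increases (\<open>gain_curvature\<close>).

  With \<open>N = Phi / phi\<close> everything at the censor point can be written through \<open>N (w - s)\<close>, \<open>N w\<close>,
  \<open>N (w + s)\<close>, \<open>N (- w)\<close> and \<open>z = 2 r s\<close>; the functions \<open>u'\<close> and \<open>u''\<close> come from implicit
  differentiation (\<open>DERIV_path_profit\<close>, \<open>DERIV_gain_rate\<close>). For \<open>r \<le> 1\<close> one has \<open>(1 - r) u \<le> u'\<close>, so
  \<open>u'' \<le> 2 (1 - r) u'\<close> suffices; for \<open>r \<ge> 1\<close> it suffices that \<open>u'' \<le> 0\<close>. After completing a square
  both are implied by inequalities that are quadratic in the ratio \<open>N (w - s) z\<close> (\<open>curvature_nonpos\<close>,
  \<open>curvature_le\<close>). Their proof needs only bounds on this ratio. These come from estimates of the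
  logarithm in \<open>z\<close> (\<open>implied_rate_le\<close>, \<open>implied_rate_ge\<close>, \<open>implied_rate_log\<close>) and from classical facts about
  the normal hazard rate: it is increasing and convex with slope below 1. All these facts express that
  the iterated integrals of the normal density are log-concave (\<open>log_concave_integral\<close>).\<close>

section \<open>The standard normal distribution function\<close>

abbreviation phi :: "real \<Rightarrow> real" where "phi \<equiv> std_normal_density"
abbreviation Phi :: "real \<Rightarrow> real" where "Phi \<equiv> std_normal_cdf"

lemma phi_pos [simp]: "phi x > 0"
  by (simp add: normal_density_pos)

lemma phi_neq_0 [simp]: "phi x \<noteq> 0"
  using phi_pos[of x] by linarith

lemma phi_minus [simp]: "phi (- x) = phi x"
  by (simp add: std_normal_density_def)

lemma DERIV_phi: "(phi has_real_derivative - x * phi x) (at x)"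
  unfolding std_normal_density_def
  by (auto intro!: derivative_eq_intros simp: field_simps)

lemma Phi_diff:
  assumes "a < b"
  shows "Phi b - Phi a = integral {a..b} phi"
proof -
  interpret real_distribution std_normal_distribution by (rule real_dist_normal_dist)
  have "Phi b - Phi a = measure std_normal_distribution {a<..b}"
    using cdf_diff_eq[OF assms] by (simp add: std_normal_cdf_def)
  also have "\<dots> = (LINT x|std_normal_distribution. indicator {a<..b} x)"
    by simp
  also have "\<dots> = set_lebesgue_integral lborel {a<..b} phi"
    unfolding set_lebesgue_integral_def
    by (subst integral_density) (simp_all add: mult.commute)
  also have "\<dots> = set_lebesgue_integral lborel {a..b} phi"
    unfolding set_lebesgue_integral_def
  proof (intro integral_cong_AE)
    show "AE x in lborel. indicator {a<..b} x *\<^sub>R phi x = indicator {a..b} x *\<^sub>R phi x"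
      using AE_lborel_singleton[of a] by eventually_elim (auto split: split_indicator)
  qed simp_all
  also have "\<dots> = integral {a..b} phi"
    by (intro set_borel_integral_eq_integral)
       (auto simp: set_integrable_def intro: integrable_mult_indicator[of _ lborel phi, simplified])
  finally show ?thesis .
qed

lemma DERIV_Phi: "(Phi has_real_derivative phi x) (at x)"
proof -
  have "continuous_on {x-1..x+1} phi"
    by (rule DERIV_continuous_on[OF DERIV_subset[OF DERIV_phi]]) simp
  then have "((\<lambda>y. integral {x-1..y} phi) has_real_derivative phi x) (at x within {x-1..x+1})"
    by (rule integral_has_real_derivative) simp
  then have "((\<lambda>y. integral {x-1..y} phi) has_real_derivative phi x) (at x)"
    by (simp add: at_within_Icc_at)
  then have d: "((\<lambda>y. Phi (x-1) + integral {x-1..y} phi) has_real_derivative phi x) (at x)"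
    using DERIV_add[OF DERIV_const[of "Phi (x-1)" "at x"]] by fastforce
  have e: "Phi (x-1) + integral {x-1..y} phi = Phi y" if "y \<in> {x-1<..}" for y
    using Phi_diff[of "x-1" y] that by simp
  show ?thesis
    by (rule has_field_derivative_transform_within_open[OF d, of "{x-1<..}"]) (use e in auto)
qed

lemmas DERIV_gauss [derivative_intros] = DERIV_phi[THEN DERIV_chain2] DERIV_Phi[THEN DERIV_chain2]

lemma tendsto_Phi_at_bot: "(Phi \<longlongrightarrow> 0) at_bot"
proof -
  interpret real_distribution std_normal_distribution by (rule real_dist_normal_dist)
  show ?thesis unfolding std_normal_cdf_def by (rule cdf_lim_at_bot)
qed

lemma tendsto_Phi_at_top: "(Phi \<longlongrightarrow> 1) at_top"
proof -
  interpret real_distribution std_normal_distribution by (rule real_dist_normal_dist)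
  show ?thesis unfolding std_normal_cdf_def by (rule cdf_lim_at_top_prob)
qed

lemma Phi_strict_mono: "x < y \<Longrightarrow> Phi x < Phi y"
proof (rule DERIV_pos_imp_increasing[of x y Phi])
  fix u :: real
  show "\<exists>d. (Phi has_real_derivative d) (at u) \<and> d > 0"
    by (rule exI[of _ "phi u"], rule conjI, rule DERIV_Phi, rule phi_pos)
qed

lemma Phi_minus: "Phi (- x) = 1 - Phi x"
proof -
  define f where "f = (\<lambda>x. Phi x + Phi (- x))"
  have "(f has_real_derivative phi x + phi (- x) * - 1) (at x)" for x
    unfolding f_def by (rule derivative_eq_intros refl | simp)+
  then have "(f has_real_derivative 0) (at x)" for x
    by simp
  then have c: "f y = f x" for y
    by (rule DERIV_isconst_all[rule_format])
  have "(f \<longlongrightarrow> 1 + 0) at_top"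
    unfolding f_def
    by (rule tendsto_add[OF tendsto_Phi_at_top
          filterlim_compose[OF tendsto_Phi_at_bot filterlim_uminus_at_bot_at_top]])
  moreover have "(f \<longlongrightarrow> f x) at_top"
    by (rule tendsto_eventually, rule always_eventually, rule allI, rule c)
  ultimately have "1 + 0 = f x"
    by (rule tendsto_unique[OF trivial_limit_at_top_linorder])
  then have "Phi x + Phi (- x) = 1" unfolding f_def by linarith
  then show ?thesis by linarith
qed

text \<open>The way in which positivity is inherited by iterated integrals from minus infinity.\<close>

lemma pos_if_increasing_from_zero:
  fixes f :: "real \<Rightarrow> real"
  assumes d: "\<And>x. (f has_real_derivative f' x) (at x)" and p: "\<And>x. f' x > 0"
    and lim: "(f \<longlongrightarrow> 0) at_bot"
  shows "f x > 0"
proof -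
  have mono: "f y < f x" if "y < x" for x y
    by (rule DERIV_pos_imp_increasing[OF that]) (use d p in blast)
  have "0 \<le> f (x - 1)"
    by (rule tendsto_upperbound[OF lim])
       (auto intro!: eventually_mono[OF eventually_le_at_bot[of "x-2"]] less_imp_le mono)
  with mono[of "x - 1" x] show ?thesis by simp
qed

lemma Phi_pos [simp]: "Phi x > 0"
  by (rule pos_if_increasing_from_zero[OF DERIV_Phi phi_pos tendsto_Phi_at_bot])

lemma Phi_less_1 [simp]: "Phi x < 1"
  using Phi_pos[of "- x"] by (simp add: Phi_minus del: Phi_pos)

lemma Phi_0: "Phi 0 = 1 / 2"
  using Phi_minus[of 0] by simp

text \<open>The change of measure behind all later simplifications: a shift of the normal density is an
  exponential tilt.\<close>

lemma phi_exp_shift: "phi (w - s) = exp (s * w - s\<^sup>2 / 2) * phi w"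
proof -
  have "- (w - s)\<^sup>2 / 2 = (s * w - s\<^sup>2 / 2) + - w\<^sup>2 / 2"
    by (simp add: power2_eq_square field_simps)
  then show ?thesis by (simp only: std_normal_density_def exp_add mult_ac)
qed

text \<open>A crude exponential tail at minus infinity, good enough to make polynomial multiples of \<open>phi\<close> and
  \<open>Phi\<close> vanish there.\<close>

lemma phi_less_exp: "phi x < exp 1 * exp x"
proof -
  have "1 / sqrt (2 * pi) < 1" using pi_gt3 by simp
  then have "1 / sqrt (2 * pi) * exp (- x\<^sup>2 / 2) < 1 * exp (- x\<^sup>2 / 2)"
    by (rule mult_strict_right_mono) simp
  also have "1 * exp (- x\<^sup>2 / 2) \<le> exp (1 + x)"
    using zero_le_power2[of "x + 1"] by (simp add: power2_eq_square algebra_simps)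
  finally show ?thesis by (simp add: std_normal_density_def exp_add)
qed

lemma Phi_less_exp: "Phi x < exp 1 * exp x"
proof -
  define f where "f = (\<lambda>x. exp 1 * exp x - Phi x)"
  have "f x > 0"
  proof (rule pos_if_increasing_from_zero[of f "\<lambda>x. exp 1 * exp x - phi x"])
    show "(f has_real_derivative exp 1 * exp x - phi x) (at x)" for x
      unfolding f_def by (rule derivative_eq_intros refl | simp)+
    show "exp 1 * exp x - phi x > 0" for x
      using phi_less_exp[of x] by simp
    show "(f \<longlongrightarrow> 0) at_bot"
      using tendsto_diff[OF tendsto_mult_left[OF exp_at_bot, of "exp 1"] tendsto_Phi_at_bot]
      by (simp add: f_def)
  qed
  then show ?thesis by (simp add: f_def)
qed

lemma tendsto_power_times_at_bot:
  fixes f :: "real \<Rightarrow> real"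
  assumes "\<And>x. 0 < f x" "\<And>x. f x < exp 1 * exp x"
  shows "((\<lambda>x. x ^ n * f x) \<longlongrightarrow> 0) at_bot"
proof (rule Lim_null_comparison)
  show "\<forall>\<^sub>F x in at_bot. norm (x ^ n * f x) \<le> exp 1 * (\<bar>x\<bar> ^ n * exp x)"
  proof (intro always_eventually allI)
    fix x :: real
    have "\<bar>x\<bar> ^ n * f x \<le> \<bar>x\<bar> ^ n * (exp 1 * exp x)"
      using assms(2)[of x] by (intro mult_left_mono) auto
    then show "norm (x ^ n * f x) \<le> exp 1 * (\<bar>x\<bar> ^ n * exp x)"
      using assms(1)[of x] by (simp add: abs_mult power_abs mult_ac)
  qed
  have "((\<lambda>x::real. x ^ n / exp x) \<longlongrightarrow> 0) at_top"
    by (rule tendsto_power_div_exp_0)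
  then have "((\<lambda>x::real. (- x) ^ n / exp (- x)) \<longlongrightarrow> 0) at_bot"
    by (rule filterlim_compose[OF _ filterlim_uminus_at_top_at_bot])
  then have "((\<lambda>x::real. \<bar>x\<bar> ^ n * exp x) \<longlongrightarrow> 0) at_bot"
    by (rule Lim_transform_eventually)
       (auto intro!: eventually_mono[OF eventually_le_at_bot[of 0]] simp: exp_minus field_simps)
  from tendsto_mult_left[OF this, of "exp 1"]
  show "((\<lambda>x::real. exp 1 * (\<bar>x\<bar> ^ n * exp x)) \<longlongrightarrow> 0) at_bot" by simp
qed

lemmas tendsto_power_Phi_at_bot = tendsto_power_times_at_bot[OF Phi_pos Phi_less_exp]
lemmas tendsto_power_phi_at_bot = tendsto_power_times_at_bot[OF phi_pos phi_less_exp]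

section \<open>Log-concavity and the normal hazard rate\<close>

text \<open>\<open>N x\<close> is the Mills ratio of the lower tail, and \<open>N1\<close> and \<open>N2\<close> are its first two derivatives. Working
  with \<open>N\<close> instead of \<open>Phi\<close> removes all exponentials, because \<open>phi (w - s)\<close>, \<open>phi (w + s)\<close> and \<open>phi w\<close>
  differ by exponential factors only.\<close>

definition N :: "real \<Rightarrow> real" where "N x = Phi x / phi x"
definition N1 :: "real \<Rightarrow> real" where "N1 x = 1 + x * N x"
definition N2 :: "real \<Rightarrow> real" where "N2 x = N x + x * N1 x"

lemma Phi_eq_N: "Phi x = phi x * N x"
  by (simp add: N_def)

lemma N_pos [simp]: "N x > 0"
  by (simp add: N_def)

lemma N_nonneg [simp]: "0 \<le> N x" and N_neq_0 [simp]: "N x \<noteq> 0"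
  using N_pos[of x] by linarith+

lemma DERIV_N: "(N has_real_derivative N1 x) (at x)"
  unfolding N_def N1_def
  by (rule derivative_eq_intros refl DERIV_phi DERIV_Phi | simp)+ (simp add: field_simps)

lemma DERIV_N1: "(N1 has_real_derivative N2 x) (at x)"
  unfolding N1_def[abs_def]
  by (rule derivative_eq_intros refl DERIV_N | simp)+ (simp add: N2_def N1_def)

text \<open>The first and the second integral of \<open>Phi\<close> from minus infinity. In probabilistic terms \<open>I1 w\<close> is the mean
  of the positive part of \<open>w - Z\<close>.\<close>

definition I1 :: "real \<Rightarrow> real" where "I1 x = phi x + x * Phi x"
definition I2 :: "real \<Rightarrow> real" where "I2 x = ((1 + x\<^sup>2) * Phi x + x * phi x) / 2"

lemma DERIV_I1: "(I1 has_real_derivative Phi x) (at x)"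
  unfolding I1_def[abs_def]
  by (rule derivative_eq_intros refl DERIV_phi DERIV_Phi | simp)+

lemma DERIV_I2: "(I2 has_real_derivative I1 x) (at x)"
  unfolding I2_def[abs_def]
  by (rule derivative_eq_intros refl DERIV_phi DERIV_Phi | simp)+
     (simp add: I1_def field_simps power2_eq_square)

lemma tendsto_I1_at_bot: "(I1 \<longlongrightarrow> 0) at_bot"
  using tendsto_add[OF tendsto_power_phi_at_bot[of 0] tendsto_power_Phi_at_bot[of 1]]
  by (simp add: I1_def[abs_def])

lemma tendsto_I2_at_bot: "(I2 \<longlongrightarrow> 0) at_bot"
proof -
  have "((\<lambda>x. (x ^ 0 * Phi x + x ^ 2 * Phi x + x ^ 1 * phi x) / 2) \<longlongrightarrow> (0 + 0 + 0) / 2) at_bot"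
    by (intro tendsto_divide tendsto_add tendsto_power_Phi_at_bot tendsto_power_phi_at_bot tendsto_const) simp
  then show ?thesis by (simp add: I2_def[abs_def] algebra_simps)
qed

lemma I1_pos [simp]: "I1 x > 0"
  by (rule pos_if_increasing_from_zero[OF DERIV_I1 Phi_pos tendsto_I1_at_bot])

lemma I2_pos: "I2 x > 0"
  by (rule pos_if_increasing_from_zero[OF DERIV_I2 I1_pos tendsto_I2_at_bot])

lemma I1_eq: "I1 x = phi x * N1 x"
  by (simp add: I1_def N1_def Phi_eq_N algebra_simps)

lemma I2_eq: "I2 x = phi x * N2 x / 2"
  by (simp add: I2_def N2_def N1_def Phi_eq_N algebra_simps power2_eq_square)

lemma N1_pos [simp]: "N1 x > 0"
  using I1_pos[of x] unfolding I1_eq by (rule zero_less_mult_pos) simp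

lemma N2_pos [simp]: "N2 x > 0"
  using I2_pos[of x] zero_less_mult_pos[of "phi x" "N2 x"] by (simp add: I2_eq)

lemma N_strict_mono: "x < y \<Longrightarrow> N x < N y"
proof (rule DERIV_pos_imp_increasing[of x y N])
  show "\<exists>d. (N has_real_derivative d) (at u) \<and> d > 0" for u
    by (rule exI[of _ "N1 u"], rule conjI, rule DERIV_N, rule N1_pos)
qed

lemma N_mono: "x \<le> y \<Longrightarrow> N x \<le> N y"
  using N_strict_mono[of x y] by (cases "x = y") auto

lemma N1_mono: "x \<le> y \<Longrightarrow> N1 x \<le> N1 y"
proof -
  have "N1 x < N1 y" if "x < y" for x y
  proof (rule DERIV_pos_imp_increasing[OF that])
    show "\<exists>d. (N1 has_real_derivative d) (at u) \<and> d > 0" for u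
      by (rule exI[of _ "N2 u"], rule conjI, rule DERIV_N1, rule N2_pos)
  qed
  then show "x \<le> y \<Longrightarrow> N1 x \<le> N1 y" by (cases "x = y") (auto simp: less_imp_le)
qed

text \<open>Integration from minus infinity preserves strict log-concavity: \<open>f1\<^sup>2 / f2 - f\<close> has the derivative
  \<open>f1 (f2\<^sup>2 - f1 f3) / f2\<^sup>2\<close>, so it increases from the limit 0.\<close>

lemma log_concave_integral:
  fixes f f1 f2 f3 :: "real \<Rightarrow> real"
  assumes d: "\<And>x. (f has_real_derivative f1 x) (at x)" "\<And>x. (f1 has_real_derivative f2 x) (at x)"
      "\<And>x. (f2 has_real_derivative f3 x) (at x)"
    and pos: "\<And>x. f1 x > 0" "\<And>x. f2 x > 0"
    and lc: "\<And>x. f1 x * f3 x < (f2 x)\<^sup>2"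
    and lim: "((\<lambda>x. (f1 x)\<^sup>2 / f2 x - f x) \<longlongrightarrow> 0) at_bot"
  shows "f x * f2 x < (f1 x)\<^sup>2"
proof -
  define g where "g = (\<lambda>x. (f1 x)\<^sup>2 / f2 x - f x)"
  define g' where "g' = (\<lambda>x. f1 x * ((f2 x)\<^sup>2 - f1 x * f3 x) / (f2 x)\<^sup>2)"
  have "g x > 0"
  proof (rule pos_if_increasing_from_zero[of g g'])
    fix x
    have "f2 x \<noteq> 0" using pos(2)[of x] by simp
    then show "(g has_real_derivative g' x) (at x)"
      unfolding g_def g'_def
      by (auto intro!: derivative_eq_intros d simp: field_simps power2_eq_square)
    show "g' x > 0"
      using pos[of x] lc[of x] by (simp add: g'_def)
  qed (use lim in \<open>simp add: g_def\<close>)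
  then show ?thesis using pos(2)[of x] by (simp add: g_def field_simps)
qed

lemma bounded_mult_tendsto_0_at_bot:
  fixes f b :: "real \<Rightarrow> real"
  assumes "(f \<longlongrightarrow> 0) at_bot" "\<And>x. x \<le> 0 \<Longrightarrow> \<bar>b x\<bar> \<le> C"
  shows "((\<lambda>x. f x * b x) \<longlongrightarrow> 0) at_bot"
proof (rule Lim_null_comparison)
  show "\<forall>\<^sub>F x in at_bot. norm (f x * b x) \<le> \<bar>f x\<bar> * C"
    using eventually_le_at_bot[of 0]
    by eventually_elim (auto simp: abs_mult intro!: mult_left_mono assms(2))
  show "((\<lambda>x. \<bar>f x\<bar> * C) \<longlongrightarrow> 0) at_bot"
    using tendsto_mult_right[OF tendsto_rabs_zero[OF assms(1)], of C] by simp
qed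

lemma I1_phi_less: "I1 x * phi x < (Phi x)\<^sup>2"
proof (rule log_concave_integral[OF DERIV_I1 DERIV_Phi DERIV_phi Phi_pos phi_pos])
  show "Phi x * (- x * phi x) < (phi x)\<^sup>2" for x
  proof -
    have "0 < phi x * I1 x" by simp
    then show ?thesis by (simp add: I1_def algebra_simps power2_eq_square)
  qed
  have "((\<lambda>x. Phi x * N x - I1 x) \<longlongrightarrow> 0 - 0) at_bot"
  proof (intro tendsto_diff tendsto_I1_at_bot bounded_mult_tendsto_0_at_bot[OF tendsto_Phi_at_bot])
    show "\<bar>N x\<bar> \<le> N 0" if "x \<le> 0" for x
      using N_mono[OF that] N_pos[of x] by (simp del: N_pos)
  qed
  then show "((\<lambda>x. (Phi x)\<^sup>2 / phi x - I1 x) \<longlongrightarrow> 0) at_bot"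
    by (simp add: N_def power2_eq_square)
qed

text \<open>Log-concavity of \<open>I1\<close>. For the hazard rate this says that its slope is less than 1.\<close>

lemma N1_less: "N1 x < (N x)\<^sup>2"
proof -
  have "(phi x)\<^sup>2 * N1 x < (phi x)\<^sup>2 * (N x)\<^sup>2"
    using I1_phi_less[of x] by (simp add: I1_eq Phi_eq_N power2_eq_square mult_ac)
  then show ?thesis by simp
qed

lemma I2_Phi_less: "I2 x * Phi x < (I1 x)\<^sup>2"
proof (rule log_concave_integral[OF DERIV_I2 DERIV_I1 DERIV_Phi I1_pos Phi_pos I1_phi_less])
  have "((\<lambda>x. I1 x * (N1 x / N x) - I2 x) \<longlongrightarrow> 0 - 0) at_bot"
  proof (intro tendsto_diff tendsto_I2_at_bot bounded_mult_tendsto_0_at_bot[OF tendsto_I1_at_bot])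
    show "\<bar>N1 x / N x\<bar> \<le> N 0" if "x \<le> 0" for x
    proof -
      have "N1 x / N x < N x"
        using N1_less[of x] by (simp add: field_simps power2_eq_square)
      then show ?thesis using N_mono[OF that] N1_pos[of x] N_pos[of x]
        by (simp add: less_imp_le)
    qed
  qed
  then show "((\<lambda>x. (I1 x)\<^sup>2 / Phi x - I2 x) \<longlongrightarrow> 0) at_bot"
    by (simp add: I1_eq Phi_eq_N power2_eq_square mult_ac)
qed

text \<open>Log-concavity of \<open>I2\<close>. For the hazard rate this says that it is convex.\<close>

lemma N_N2_less: "N x * N2 x < 2 * (N1 x)\<^sup>2"
proof -
  have "(phi x)\<^sup>2 * (N x * N2 x) < (phi x)\<^sup>2 * (2 * (N1 x)\<^sup>2)"
    using I2_Phi_less[of x] by (simp add: I1_eq I2_eq Phi_eq_N power2_eq_square mult_ac)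
  then show ?thesis by (simp add: mult_less_cancel_left)
qed

text \<open>\<open>N\<close> itself is log-convex, since \<open>N N2 - N1\<^sup>2 = N\<^sup>2 - N1\<close>.\<close>

lemma N1_sq_less: "(N1 x)\<^sup>2 < N x * N2 x"
proof -
  have "N x * N2 x - (N1 x)\<^sup>2 = (N x)\<^sup>2 - N1 x"
    by (simp add: N2_def N1_def power2_eq_square algebra_simps)
  with N1_less[of x] show ?thesis by linarith
qed

text \<open>The value of the hazard rate at 0; its square \<open>2 / pi\<close> is the slope there, and its inverse is \<open>N 0\<close>.\<close>

definition kap :: real where "kap = sqrt (2 / pi)"

lemma kap_sq: "kap * kap = 2 / pi"
  by (simp add: kap_def)

lemma two_div_pi_bounds: "6366 / 10000 < 2 / pi" "2 / pi < 6367 / 10000"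
  using pi_approx by (simp_all add: field_simps)

lemma kap_bounds: "7978 / 10000 < kap" "kap < 798 / 1000"
proof -
  show "7978 / 10000 < kap"
    unfolding kap_def by (rule real_less_rsqrt) (use two_div_pi_bounds in \<open>simp add: power2_eq_square\<close>)
  show "kap < 798 / 1000"
    unfolding kap_def by (rule real_less_lsqrt) (use two_div_pi_bounds in \<open>simp_all add: power2_eq_square\<close>)
qed

lemma kap_pos [simp]: "kap > 0"
  using kap_bounds by simp

lemma kap_nonneg [simp]: "0 \<le> kap" and kap_neq_0 [simp]: "kap \<noteq> 0"
  using kap_pos by linarith+

lemma phi_0: "phi 0 = kap / 2"
proof -
  have "(kap * sqrt (2 * pi))\<^sup>2 = 2\<^sup>2"
    by (simp add: kap_def power_mult_distrib)
  then have "kap * sqrt (2 * pi) = 2"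
    by (rule power2_eq_imp_eq) (simp_all add: kap_def)
  then show ?thesis by (simp add: std_normal_density_def field_simps)
qed

lemma N_0: "N 0 = 1 / kap"
  by (simp add: N_def phi_0 Phi_0)

text \<open>The hazard rate \<open>phi x / Phi (- x)\<close> of the standard normal distribution.\<close>

definition hazard :: "real \<Rightarrow> real" where "hazard x = 1 / N (- x)"

lemma hazard_pos [simp]: "hazard x > 0"
  by (simp add: hazard_def)

lemma hazard_nonneg [simp]: "0 \<le> hazard x" and hazard_neq_0 [simp]: "hazard x \<noteq> 0"
  using hazard_pos[of x] by linarith+

lemma hazard_0: "hazard 0 = kap"
  by (simp add: hazard_def N_0)

lemma hazard_gap: "hazard x - x = N1 (- x) / N (- x)"
  by (simp add: hazard_def N1_def field_simps)

lemma hazard_gt: "x < hazard x"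
  using hazard_gap[of x] N1_pos[of "-x"] N_pos[of "-x"] by (smt (verit) divide_pos_pos)

lemma DERIV_hazard: "(hazard has_real_derivative hazard x * (hazard x - x)) (at x)"
proof -
  have "((\<lambda>x. N (- x)) has_real_derivative N1 (- x) * - 1) (at x)"
    by (rule DERIV_chain2[OF DERIV_N]) (auto intro!: derivative_eq_intros)
  from DERIV_divide[OF DERIV_const this, of 1]
  have "(hazard has_real_derivative N1 (- x) / (N (- x) * N (- x))) (at x)"
    by (simp add: hazard_def[abs_def])
  then show ?thesis by (simp add: hazard_gap) (simp add: hazard_def)
qed

lemma hazard_slope_less_1: "hazard x * (hazard x - x) < 1"
  using N1_less[of "- x"] unfolding hazard_gap unfolding hazard_def by (simp add: power2_eq_square)

text \<open>Sampford's inequality. As \<open>hazard x * (hazard x - x)\<close> is the derivative of the hazard rate, its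
  second derivative is \<open>hazard x * ((hazard x - x) * (2 * hazard x - x) - 1)\<close>.\<close>

lemma hazard_sampford: "(hazard x - x) * (2 * hazard x - x) > 1"
proof -
  have "N1 (- x) * (N1 (- x) + 1) > (N (- x))\<^sup>2"
    using N_N2_less[of "- x"] by (simp add: N2_def N1_def power2_eq_square algebra_simps)
  moreover have "2 * hazard x - x = (N1 (- x) + 1) / N (- x)"
    by (simp add: hazard_def N1_def field_simps)
  ultimately show ?thesis
    unfolding hazard_gap \<open>2 * hazard x - x = _\<close> by (simp add: power2_eq_square less_divide_eq)
qed

lemma hazard_mono: "x \<le> y \<Longrightarrow> hazard x \<le> hazard y"
  using N_mono[of "- y" "- x"] by (simp add: hazard_def frac_le)

lemma hazard_gap_antimono: "x \<le> y \<Longrightarrow> hazard y - y \<le> hazard x - x"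
proof -
  assume "x \<le> y"
  then show ?thesis
  proof (rule DERIV_nonpos_imp_nonincreasing)
    fix u
    have "((\<lambda>x. hazard x - x) has_real_derivative hazard u * (hazard u - u) - 1) (at u)"
      by (intro DERIV_diff DERIV_hazard DERIV_ident)
    then show "\<exists>d. ((\<lambda>x. hazard x - x) has_real_derivative d) (at u) \<and> d \<le> 0"
      using hazard_slope_less_1[of u] by (intro exI conjI) auto
  qed
qed

lemma hazard_slope_mono: "x \<le> y \<Longrightarrow> hazard x * (hazard x - x) \<le> hazard y * (hazard y - y)"
proof -
  assume "x \<le> y"
  then show ?thesis
  proof (rule DERIV_nonneg_imp_nondecreasing)
    fix u
    have "((\<lambda>x. hazard x * (hazard x - x)) has_real_derivative
        hazard u * ((hazard u - u) * (2 * hazard u - u) - 1)) (at u)"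
      by (rule derivative_eq_intros DERIV_hazard refl | simp)+ (simp add: algebra_simps)
    then show "\<exists>d. ((\<lambda>x. hazard x * (hazard x - x)) has_real_derivative d) (at u) \<and> d \<ge> 0"
      using hazard_sampford[of u] hazard_pos[of u] by (intro exI conjI) (assumption, intro mult_nonneg_nonneg, simp_all)
  qed
qed

text \<open>The chord of a convex function that has slope below 1.\<close>

lemma hazard_chord_bounds:
  assumes "a \<le> b"
  shows "hazard a * (hazard a - a) * (b - a) \<le> hazard b - hazard a" "hazard b - hazard a \<le> b - a"
proof -
  show "hazard b - hazard a \<le> b - a" using hazard_gap_antimono[OF assms] by simp
  have "\<exists>z. a < z \<and> z < b \<and> hazard b - hazard a = (b - a) * (hazard z * (hazard z - z))" if "a < b"
    by (rule MVT2[OF that]) (rule DERIV_hazard)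
  then show "hazard a * (hazard a - a) * (b - a) \<le> hazard b - hazard a"
    using assms hazard_slope_mono
    by (cases "a = b") (force simp: mult.commute intro: mult_left_mono)+
qed

lemma hazard_ge_tangent_0: "0 \<le> x \<Longrightarrow> kap + kap * kap * x \<le> hazard x"
  using hazard_chord_bounds(1)[of 0 x] by (simp add: hazard_0)

lemma hazard_le: "0 \<le> x \<Longrightarrow> hazard x \<le> x + kap"
  using hazard_chord_bounds(2)[of 0 x] by (simp add: hazard_0)

text \<open>For \<open>t \<ge> x \<ge> 0\<close> the left-hand side of Sampford's inequality increases in \<open>t\<close>.\<close>

lemma hazard_ge_of_sampford:
  assumes "0 \<le> x" "(t - x) * (2 * t - x) \<le> 1"
  shows "t \<le> hazard x"
proof (rule ccontr)
  assume "\<not> t \<le> hazard x"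
  with hazard_gt[of x] assms(1) have "(hazard x - x) * (2 * hazard x - x) \<le> (t - x) * (2 * t - x)"
    by (intro mult_mono) auto
  with hazard_sampford[of x] assms(2) show False by linarith
qed

text \<open>The two linear bounds are tangents, at \<open>x = 1\<close> and at \<open>x = 7 / 2\<close>, to the curve
  \<open>h = (3 * x + sqrt (x\<^sup>2 + 8)) / 4\<close> on which Sampford's inequality would be an equality.\<close>

lemma hazard_ge_1: "0 \<le> x \<Longrightarrow> (4 + 5 * x) / 6 \<le> hazard x"
  by (rule hazard_ge_of_sampford) (use zero_le_power2[of "x - 1"] in \<open>simp_all add: field_simps power2_eq_square\<close>)

lemma hazard_ge_2: "0 \<le> x \<Longrightarrow> (8 + 17 * x) / 18 \<le> hazard x"
  by (rule hazard_ge_of_sampford) (use zero_le_power2[of "2 * x - 7"] in \<open>simp_all add: field_simps power2_eq_square\<close>)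

lemma N_ge_quadratic: "0 \<le> y \<Longrightarrow> 1 / kap + y + y\<^sup>2 / (2 * kap) \<le> N y"
proof -
  assume y: "0 \<le> y"
  have "N 0 - (1 / kap + 0 + 0\<^sup>2 / (2 * kap)) \<le> N y - (1 / kap + y + y\<^sup>2 / (2 * kap))"
    using y
  proof (rule DERIV_nonneg_imp_nondecreasing)
    fix u :: real assume u: "0 \<le> u" "u \<le> y"
    have d: "((\<lambda>y. N y - (1 / kap + y + y\<^sup>2 / (2 * kap))) has_real_derivative N1 u - (1 + u / kap)) (at u)"
      by (auto intro!: derivative_eq_intros DERIV_N simp: field_simps)
    have "u * (1 / kap) \<le> u * N u"
      using N_mono[of 0 u] u by (intro mult_left_mono) (auto simp: N_0)
    then have "N1 u - (1 + u / kap) \<ge> 0" by (simp add: N1_def)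
    with d show "\<exists>d. ((\<lambda>y. N y - (1 / kap + y + y\<^sup>2 / (2 * kap))) has_real_derivative d) (at u) \<and> 0 \<le> d"
      by blast
  qed
  then show ?thesis by (simp add: N_0)
qed

section \<open>Reduction of the curvature bound\<close>

text \<open>With \<open>z = 2 r s\<close> this is the derivative of \<open>gain_rate r\<close> at \<open>s\<close>, up to the positive factor
  \<open>scaled_mean s w * phi w / s\<close>.\<close>

definition curvature :: "real \<Rightarrow> real \<Rightarrow> real \<Rightarrow> real" where
  "curvature s w z = N (w + s) * (2 * s - z)\<^sup>2 / 2 + z\<^sup>2 * N (w - s) / 2 + 2 * s + (hazard w - w) - 2 * z
     - 2 * z * hazard w * N (w - s) + z\<^sup>2 * (N (w - s))\<^sup>2 * hazard w"

lemma curvature_eq: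
  "curvature s w z = N (w + s) * (2 * s - z)\<^sup>2 / 2 + z\<^sup>2 * N (w - s) / 2 + 2 * (s - z) - w
     + hazard w * (1 - N (w - s) * z)\<^sup>2"
  by (simp add: curvature_def power2_eq_square algebra_simps)

text \<open>The case \<open>r \<ge> 1\<close>: while the profit does not fall, \<open>z - 2 s\<close> is at most \<open>z N (w - s) / N (w + s)\<close>. This
  turns the only term of the curvature with \<open>N (w + s)\<close> into one with \<open>N (w - s)\<close>, and what remains
  is quadratic in \<open>N (w - s) * z\<close>.\<close>

lemma curvature_nonpos:
  assumes z: "0 < z" "2 * s \<le> z" and v: "z * (N (w + s) - N (w - s)) \<le> 2 * s * N (w + s)"
    and h: "hazard w * (1 - N (w - s) * z)\<^sup>2 \<le> w + (2 - N (w - s) * z) * (z - s)"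
  shows "curvature s w z \<le> 0"
proof -
  have "(z - 2 * s) * N (w + s) \<le> z * N (w - s)" using v by (simp add: algebra_simps)
  then have "(z - 2 * s) * ((z - 2 * s) * N (w + s)) \<le> (z - 2 * s) * (z * N (w - s))"
    using z by (intro mult_left_mono) auto
  with h show ?thesis unfolding curvature_eq by (simp add: power2_eq_square field_simps)
qed

text \<open>Up to positive factors the curvature is \<open>u''\<close>, the square on the right is \<open>4 u'\<^sup>2\<close>, and \<open>N (w + s)\<close>
  is an upper bound of \<open>u\<close>. For \<open>z \<ge> 2 s\<close> the first alternative holds.

  For \<open>z \<le> 2 s\<close> put \<open>D = 2 * s - z\<close>, so that \<open>D / (2 s) = 1 - r\<close>. Both \<open>curvature \<le> D y\<close> and
  \<open>D N (w + s) \<le> y\<close> hold for the number \<open>y\<close> that is squared. The first of them is quadratic in \<open>D\<close>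
  and follows from \<open>lo\<close> by completing the square if \<open>t \<le> 1\<close>; if \<open>t \<ge> 1\<close> all terms with \<open>D\<close> have
  the favourable sign.\<close>

lemma curvature_le:
  fixes w s z defines "t \<equiv> N (w - s) * z"
  assumes s: "0 < s" and z: "0 < z" and v: "z * (N (w + s) - N (w - s)) \<le> 2 * s * N (w + s)"
    and t: "t \<le> 2"
    and lo: "t \<le> 1 \<Longrightarrow> (hazard w + 1 / (2 * N (w + s))) * (1 - t)\<^sup>2 \<le> w + z * (1 - t / 2)"
    and hi: "1 \<le> t \<Longrightarrow> hazard w * (1 - t)\<^sup>2 \<le> w + z * (1 - t / 2)"
  shows "curvature s w z \<le> 0 \<or> N (w + s) * curvature s w z \<le> (2 * s * N (w + s) - z * (N (w + s) - N (w - s)))\<^sup>2"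
proof (cases "2 * s \<le> z")
  case True
  have "hazard w * (1 - t)\<^sup>2 \<le> w + z * (1 - t / 2)"
  proof (cases "1 \<le> t")
    case False
    have "hazard w * (1 - t)\<^sup>2 \<le> (hazard w + 1 / (2 * N (w + s))) * (1 - t)\<^sup>2"
      by (intro mult_right_mono) auto
    also have "\<dots> \<le> w + z * (1 - t / 2)" using lo False by simp
    finally show ?thesis .
  qed (use hi in simp)
  also have "z * (1 - t / 2) = (2 - t) * (z / 2)" by (simp add: algebra_simps)
  also have "\<dots> \<le> (2 - t) * (z - s)" using t True by (intro mult_left_mono) auto
  finally have "curvature s w z \<le> 0"
    using True z v by (intro curvature_nonpos) (auto simp: t_def)
  then show ?thesis ..
next
  case False
  define D where "D = 2 * s - z"
  define e where "e = N (w + s)"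
  define a where "a = N (w - s)"
  have D: "D > 0" using False by (simp add: D_def)
  have e: "e > 0" and a: "a > 0" by (simp_all add: e_def a_def)
  have "hazard w * (1 - t)\<^sup>2 \<le> w + z * (1 - t / 2) - D * (1 - t) + e * D\<^sup>2 / 2"
  proof (cases "1 \<le> t")
    case True
    then have "0 \<le> D * (t - 1)" "0 \<le> e * D\<^sup>2 / 2" using D e by auto
    with hi True show ?thesis by (simp add: algebra_simps)
  next
    case False
    \<comment> \<open>The square is completed in \<open>D\<close>; its constant term is the correction to \<open>hazard w\<close> in \<open>lo\<close>.\<close>
    have "0 \<le> e / 2 * (D - (1 - t) / e)\<^sup>2" using e by simp
    also have "\<dots> = e * D\<^sup>2 / 2 - D * (1 - t) + (1 - t)\<^sup>2 / (2 * e)"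
      using e by (simp add: power2_eq_square field_simps)
    finally show ?thesis using lo False by (simp add: e_def algebra_simps)
  qed
  then have "curvature s w z \<le> D * (D * e + z * a)"
    unfolding curvature_eq D_def e_def a_def t_def by (simp add: power2_eq_square field_simps)
  then have "e * curvature s w z \<le> (D * e) * (D * e + z * a)"
    using e by (simp add: mult_ac mult_left_mono)
  also have "\<dots> \<le> (D * e + z * a) * (D * e + z * a)"
    using D e a z by (intro mult_right_mono) auto
  also have "D * e + z * a = 2 * s * N (w + s) - z * (N (w + s) - N (w - s))"
    by (simp add: D_def e_def a_def algebra_simps)
  finally show ?thesis by (simp add: e_def power2_eq_square)
qed

text \<open>The mean of \<open>min (X / c) 1\<close>, that is, of \<open>exp (- s V)\<close> with \<open>V\<close> the positive part of \<open>w - Z\<close>.\<close>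

definition scaled_mean :: "real \<Rightarrow> real \<Rightarrow> real" where
  "scaled_mean s w = phi w * (N (w - s) + N (- w))"

text \<open>The number \<open>2 r s\<close> for the rate \<open>r\<close> that makes \<open>w\<close> the censor point: by definition of the latter,
  \<open>exp (- r s\<^sup>2)\<close> is \<open>c\<close> times the scaled mean.\<close>

definition implied_rate :: "real \<Rightarrow> real \<Rightarrow> real" where
  "implied_rate s w = s - 2 * w - 2 * ln (scaled_mean s w) / s"

lemma N_sum_pos [simp]: "0 < N x + N y" "N x + N y \<noteq> 0" "0 \<le> N x + N y"
  using N_pos[of x] N_pos[of y] by (auto intro: add_pos_pos less_imp_neq[symmetric] simp del: N_pos)

lemma scaled_mean_pos [simp]: "scaled_mean s w > 0"
  by (simp add: scaled_mean_def)

lemma phi_N_sum: "phi x * (N x + N (- x)) = 1"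
  using Phi_minus[of x] by (simp add: Phi_eq_N algebra_simps)

lemma scaled_mean_0: "scaled_mean 0 w = 1"
  by (simp add: scaled_mean_def phi_N_sum)

lemma implied_rate_log: "s \<noteq> 0 \<Longrightarrow> s * implied_rate s w = 2 * ln ((N (w - s) + N (s - w)) / (N (w - s) + N (- w)))"
proof -
  assume s: "s \<noteq> 0"
  define E where "E = exp (s * w - s\<^sup>2 / 2)"
  have E: "E > 0" by (simp add: E_def)
  have "E * phi w * (N (w - s) + N (s - w)) = 1"
    using phi_N_sum[of "w - s"] unfolding phi_exp_shift E_def[symmetric] by simp
  then have 1: "N (w - s) + N (s - w) = 1 / (E * phi w)"
    using E by (simp add: eq_divide_eq mult.commute)
  have "(N (w - s) + N (s - w)) / (N (w - s) + N (- w)) = inverse E / scaled_mean s w"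
    unfolding 1 by (simp add: scaled_mean_def divide_inverse mult_ac)
  then have "ln ((N (w - s) + N (s - w)) / (N (w - s) + N (- w))) = - ln E - ln (scaled_mean s w)"
    using E scaled_mean_pos[of s w] by (simp add: ln_div ln_inverse del: scaled_mean_pos)
  also have "ln E = s * w - s\<^sup>2 / 2" by (simp add: E_def)
  finally have "ln ((N (w - s) + N (s - w)) / (N (w - s) + N (- w))) = - (s * w - s\<^sup>2 / 2) - ln (scaled_mean s w)" .
  moreover have "s * implied_rate s w = s\<^sup>2 - 2 * (s * w) - 2 * ln (scaled_mean s w)"
    using s by (simp add: implied_rate_def algebra_simps power2_eq_square)
  ultimately show ?thesis by simp
qed

lemma N_chord:
  assumes "a \<le> b"
  shows "N1 a * (b - a) \<le> N b - N a" "N b - N a \<le> N1 b * (b - a)"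
proof -
  have "\<exists>z. a < z \<and> z < b \<and> N b - N a = (b - a) * N1 z" if "a < b"
    by (rule MVT2[OF that]) (rule DERIV_N)
  then have "N1 a * (b - a) \<le> N b - N a \<and> N b - N a \<le> N1 b * (b - a)"
  proof (cases "a = b")
    case False
    then have "a < b" using assms by simp
    with \<open>a < b \<Longrightarrow> _\<close> obtain z where z: "a < z" "z < b" "N b - N a = (b - a) * N1 z" by blast
    then show ?thesis
      using N1_mono[of a z] N1_mono[of z b] by (auto simp: mult.commute intro!: mult_right_mono)
  qed simp
  then show "N1 a * (b - a) \<le> N b - N a" "N b - N a \<le> N1 b * (b - a)" by auto
qed

text \<open>Jensen's inequality for \<open>exp (- s V)\<close>, as \<open>I1 w\<close> is the mean of \<open>V\<close>. Analytically: the logarithm of the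
  scaled mean is convex in \<open>s\<close>, so it lies above its tangent at 0.\<close>

lemma minus_ln_scaled_mean_le:
  assumes "0 \<le> s"
  shows "- ln (scaled_mean s w) \<le> s * I1 w"
proof -
  define f where "f = (\<lambda>s. ln (scaled_mean s w) + s * I1 w)"
  have ratio_mono: "N1 u / (N u + N (- w)) \<le> N1 v / (N v + N (- w))" if "u \<le> v" for u v
    using that
  proof (rule DERIV_nonneg_imp_nondecreasing)
    fix x
    have "N2 x * N (- w) > 0" by (rule mult_pos_pos) simp_all
    moreover have "N1 x * N1 x < N x * N2 x"
      using N1_sq_less[of x] by (simp add: power2_eq_square)
    moreover have "N2 x * (N x + N (- w)) = N x * N2 x + N2 x * N (- w)"
      by (simp add: algebra_simps)
    ultimately have "N2 x * (N x + N (- w)) - N1 x * N1 x > 0"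
      by linarith
    moreover have "((\<lambda>x. N1 x / (N x + N (- w))) has_real_derivative
        (N2 x * (N x + N (- w)) - N1 x * (N1 x + 0)) / ((N x + N (- w)) * (N x + N (- w)))) (at x)"
      by (intro DERIV_divide DERIV_add DERIV_N DERIV_N1 DERIV_const) simp
    moreover have "0 < (N x + N (- w)) * (N x + N (- w))" by simp
    ultimately show "\<exists>d. ((\<lambda>x. N1 x / (N x + N (- w))) has_real_derivative d) (at x) \<and> d \<ge> 0"
      by (metis (no_types, lifting) add.right_neutral divide_pos_pos less_imp_le)
  qed
  have I1: "I1 w = N1 w / (N w + N (- w))"
    using phi_N_sum[of w] by (simp add: I1_eq field_simps)
  have "f 0 \<le> f s"
    using assms
  proof (rule DERIV_nonneg_imp_nondecreasing)
    fix x :: real assume x: "0 \<le> x"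
    have "((\<lambda>x. N (w - x)) has_real_derivative N1 (w - x) * (0 - 1)) (at x)"
      by (rule DERIV_chain2[OF DERIV_N]) (intro DERIV_diff DERIV_const DERIV_ident)
    then have c: "((\<lambda>x. scaled_mean x w) has_real_derivative phi w * (N1 (w - x) * (0 - 1) + 0)) (at x)"
      unfolding scaled_mean_def by (intro DERIV_cmult DERIV_add DERIV_const)
    have "(f has_real_derivative 1 / scaled_mean x w * (phi w * (N1 (w - x) * (0 - 1) + 0)) + 1 * I1 w) (at x)"
      unfolding f_def
      by (intro DERIV_add DERIV_chain2[OF DERIV_ln_divide c] DERIV_cmult_right DERIV_ident) simp
    moreover have "1 / scaled_mean x w * (phi w * (N1 (w - x) * (0 - 1) + 0)) + 1 * I1 w
        = N1 w / (N w + N (- w)) - N1 (w - x) / (N (w - x) + N (- w))"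
      by (simp add: I1 scaled_mean_def)
    moreover have "\<dots> \<ge> 0" using ratio_mono[of "w - x" w] x by simp
    ultimately show "\<exists>d. (f has_real_derivative d) (at x) \<and> 0 \<le> d"
      by auto
  qed
  then show ?thesis by (simp add: f_def scaled_mean_0)
qed

lemma implied_rate_le: "0 < s \<Longrightarrow> implied_rate s w \<le> s - 2 * w + 2 * I1 w"
  using minus_ln_scaled_mean_le[of s w] by (simp add: implied_rate_def field_simps)

text \<open>From \<open>ln q \<le> q - 1\<close> for the scaled mean \<open>q\<close>, and the convexity of \<open>N\<close>.\<close>

lemma implied_rate_ge: "0 < s \<Longrightarrow> s - 2 * w + 2 * phi w * N1 (w - s) \<le> implied_rate s w"
proof -
  assume s: "0 < s"
  have "scaled_mean s w = 1 - phi w * (N w - N (w - s))"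
    using phi_N_sum[of w] by (simp add: scaled_mean_def algebra_simps)
  also have "\<dots> \<le> 1 - phi w * (N1 (w - s) * s)"
    using N_chord(1)[of "w - s" w] s by (intro diff_left_mono mult_left_mono) auto
  finally have "phi w * N1 (w - s) * s \<le> - ln (scaled_mean s w)"
    using ln_le_minus_one[OF scaled_mean_pos[of s w]] by simp
  then show ?thesis using s by (simp add: implied_rate_def field_simps)
qed

section \<open>Scales below a positive threshold\<close>

lemma Phi_le_linear: "0 \<le> w \<Longrightarrow> 2 * Phi w \<le> 1 + kap * w"
proof -
  assume w: "0 \<le> w"
  have "2 * Phi 0 - (1 + kap * 0) \<ge> 2 * Phi w - (1 + kap * w)"
    using w
  proof (rule DERIV_nonpos_imp_nonincreasing)
    fix u :: real
    have "exp (- u\<^sup>2 / 2) \<le> 1" for u :: real by simp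
    then have "1 / sqrt (2 * pi) * exp (- u\<^sup>2 / 2) \<le> 1 / sqrt (2 * pi) * 1"
      by (intro mult_left_mono) simp_all
    then have "phi u \<le> phi 0" by (simp add: std_normal_density_def)
    then have "2 * phi u \<le> kap" by (simp add: phi_0)
    moreover have "((\<lambda>u. 2 * Phi u - (1 + kap * u)) has_real_derivative 2 * phi u - (0 + kap * 1)) (at u)"
      by (intro DERIV_diff DERIV_add DERIV_cmult DERIV_Phi DERIV_const DERIV_ident)
    ultimately show "\<exists>d. ((\<lambda>u. 2 * Phi u - (1 + kap * u)) has_real_derivative d) (at u) \<and> d \<le> 0"
      by (intro exI conjI) auto
  qed
  then show ?thesis by (simp add: Phi_0)
qed

lemma N_ge_linear: "0 \<le> y \<Longrightarrow> 1 / kap + y \<le> N y"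
  using N_ge_quadratic[of y] by (smt (verit) kap_nonneg divide_nonneg_nonneg zero_le_power2)

lemma Phi_quotient: "N w / (N w + N (- w)) = Phi w"
  using phi_N_sum[of w] by (simp add: Phi_eq_N field_simps)

lemma hazard_N: "hazard w * N (- w) = 1"
  by (simp add: hazard_def)

lemma inverse_kap_sq: "157 / 100 < 1 / (kap * kap)" "1 / (kap * kap) < 15709 / 10000"
  using pi_approx by (simp_all add: kap_sq field_simps)

text \<open>Both inequalities \<open>1 - 1 / x \<le> ln x \<le> x - 1\<close> are applied to the logarithm in \<open>implied_rate_log\<close>. The
  difference \<open>N (s - w) - N (- w)\<close> is then estimated by convexity of \<open>N\<close>, or by the slope of the hazard
  rate. The bound by \<open>1 + kap * w\<close> is the sharper one for small \<open>w\<close>.\<close>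

lemma ratio_bounds_small_scale:
  fixes s w defines "t \<equiv> N (w - s) * implied_rate s w"
  assumes s: "0 < s" and w: "s \<le> w"
  shows "N1 (- w) \<le> t" "t \<le> 1 + kap * w" "t \<le> 1 / (kap * kap)"
proof -
  define a g b where "a = N (w - s)" "g = N (s - w)" "b = N (- w)"
  note d = a_g_b_def
  have pos: "0 < a" "0 < g" "0 < b" by (simp_all add: d)
  have ag: "g \<le> a" unfolding d using w by (intro N_mono) simp
  have bg: "b \<le> g" unfolding d using s by (intro N_mono) simp
  have z: "s * implied_rate s w = 2 * ln ((a + g) / (a + b))"
    using implied_rate_log[of s w] s by (simp add: d)
  have e: "N1 (- w) * s \<le> g - b" "g - b \<le> N1 (s - w) * s"
    using N_chord[of "- w" "s - w"] s by (simp_all add: d)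
  have "ln ((a + b) / (a + g)) \<le> (a + b) / (a + g) - 1"
    using pos by (intro ln_le_minus_one divide_pos_pos) auto
  then have lo: "s * implied_rate s w \<ge> 2 * ((g - b) / (a + g))"
    using pos unfolding z by (simp add: ln_div field_simps)
  have "ln ((a + g) / (a + b)) \<le> (a + g) / (a + b) - 1"
    using pos by (intro ln_le_minus_one divide_pos_pos) auto
  then have up: "s * implied_rate s w \<le> 2 * ((g - b) / (a + b))"
    using pos unfolding z by (simp add: field_simps)
  have "s * N1 (- w) * (a + g) \<le> (g - b) * (2 * a)"
    using e(1) ag pos bg by (intro mult_mono) (auto simp: mult.commute)
  then have "s * N1 (- w) \<le> a * (2 * ((g - b) / (a + g)))"
    using pos by (simp add: pos_le_divide_eq mult_ac)
  also have "\<dots> \<le> a * (s * implied_rate s w)" using lo pos by (intro mult_left_mono) auto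
  also have "\<dots> = s * t" by (simp add: t_def d mult_ac)
  finally show "N1 (- w) \<le> t" using s by simp

  have "(N w) / (N w + b) - a / (a + b) = b * (N w - a) / ((N w + b) * (a + b))"
    using pos N_pos[of w] by (simp add: d field_simps)
  also have "\<dots> \<ge> 0"
    using N_mono[of "w - s" w] s pos by (intro divide_nonneg_nonneg mult_nonneg_nonneg) (auto simp: d)
  finally have q: "2 * (a / (a + b)) \<le> 1 + kap * w"
    using Phi_quotient[of w] Phi_le_linear[of w] s w by (simp add: d)
  have qp: "0 \<le> a / (a + b)" using pos by simp

  have "s * t = a * (s * implied_rate s w)" by (simp add: t_def d mult_ac)
  also have "\<dots> \<le> a * (2 * ((g - b) / (a + b)))" using up pos by (intro mult_left_mono) auto
  also have "\<dots> = 2 * (a / (a + b)) * (g - b)" by simp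
  finally have st: "s * t \<le> 2 * (a / (a + b)) * (g - b)" .

  have "N1 (s - w) \<le> 1"
    using w mult_nonneg_nonneg[of "w - s" "N (s - w)"] by (simp add: N1_def algebra_simps)
  then have "g - b \<le> s"
    using e(2) s mult_right_mono[of "N1 (s - w)" 1 s] by linarith
  then have "2 * (a / (a + b)) * (g - b) \<le> (1 + kap * w) * s"
    using q qp bg by (intro mult_mono) auto
  with st have "s * t \<le> s * (1 + kap * w)" by (simp add: mult.commute)
  then show "t \<le> 1 + kap * w" using s by simp

  have "hazard w - hazard (w - s) \<le> s" using hazard_chord_bounds(2)[of "w - s" w] s by simp
  then have "1 / b - 1 / g \<le> s" by (simp add: hazard_def d)
  then have gb: "g - b \<le> s * (b * g)" using pos by (simp add: field_simps)
  have g: "g \<le> 1 / kap" using N_mono[of "s - w" 0] w by (simp add: d N_0)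
  have "b = 1 / hazard w" by (simp add: d hazard_def)
  also have "\<dots> \<le> 1 / (kap * (1 + kap * w))"
    using hazard_ge_tangent_0[of w] s w by (intro divide_left_mono) (auto simp: algebra_simps add_pos_nonneg)
  finally have "b * g \<le> 1 / (kap * (1 + kap * w)) * (1 / kap)"
    using g pos s w by (intro mult_mono) auto
  then have "(1 + kap * w) * (s * (b * g)) \<le> (1 + kap * w) * (s * (1 / (kap * (1 + kap * w)) * (1 / kap)))"
    using s w by (intro mult_left_mono) auto
  also have "\<dots> = s * (1 / (kap * kap))"
  proof -
    have "1 + kap * w \<noteq> 0" using s w mult_nonneg_nonneg[of kap w] by (simp add: add_nonneg_eq_0_iff)
    then show ?thesis by simp
  qed
  finally have "(1 + kap * w) * (s * (b * g)) \<le> s * (1 / (kap * kap))" .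
  moreover have "2 * (a / (a + b)) * (g - b) \<le> (1 + kap * w) * (s * (b * g))"
    using q order_trans[OF _ q, of 0] qp bg gb by (intro mult_mono) (auto simp del: times_divide_eq_right)
  ultimately have "s * t \<le> s * (1 / (kap * kap))" using st by linarith
  then show "t \<le> 1 / (kap * kap)" using s by (rule mult_left_le_imp_le)
qed

text \<open>For \<open>t \<le> 1\<close> the bound \<open>1 - t \<le> w N (- w)\<close> gives \<open>hazard w * (1 - t)\<^sup>2 \<le> w * (w N (- w))\<close>, and
  Sampford's inequality leaves room for the correction by \<open>1 / (2 N (w + s))\<close>.\<close>

lemma premises_small_scale:
  fixes s w defines "t \<equiv> N (w - s) * implied_rate s w"
  assumes s: "0 < s" and w: "s \<le> w" and z: "0 < implied_rate s w"
  shows "t \<le> 2"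
    "t \<le> 1 \<Longrightarrow> (hazard w + 1 / (2 * N (w + s))) * (1 - t)\<^sup>2 \<le> w + implied_rate s w * (1 - t / 2)"
    "1 \<le> t \<Longrightarrow> hazard w * (1 - t)\<^sup>2 \<le> w + implied_rate s w * (1 - t / 2)"
proof -
  note t = ratio_bounds_small_scale[OF s w, folded t_def]
  have w0: "w > 0" using s w by simp
  show t2: "t \<le> 2" using t(3) inverse_kap_sq by linarith
  have zt: "0 \<le> implied_rate s w * (1 - t / 2)" using z t2 by simp
  define b where "b = N (- w)"
  have b: "b > 0" "hazard w * b = 1" by (simp_all add: b_def hazard_N)
  have wb: "1 - N1 (- w) = w * b" "w * b < 1"
    using N1_pos[of "- w"] by (simp_all add: N1_def b_def del: N1_pos)
  show "(hazard w + 1 / (2 * N (w + s))) * (1 - t)\<^sup>2 \<le> w + implied_rate s w * (1 - t / 2)" if "t \<le> 1"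
  proof -
    have "(1 - t)\<^sup>2 \<le> (w * b)\<^sup>2" using that t(1) wb(1) by (intro power_mono) auto
    then have "(hazard w + 1 / (2 * N (w + s))) * (1 - t)\<^sup>2 \<le> (hazard w + 1 / (2 * N (w + s))) * (w * b)\<^sup>2"
      by (intro mult_left_mono) auto
    also have "\<dots> = w * (w * b * (hazard w * b) + w * b * (b / (2 * N (w + s))))"
      by (simp add: power2_eq_square field_simps)
    also have "\<dots> \<le> w * 1"
    proof (intro mult_left_mono)
      have "1 < (hazard w - w) * (2 * (hazard w - w) + w)" using hazard_sampford[of w] by simp
      also have "\<dots> \<le> (hazard w - w) * (2 * kap + w)"
        using hazard_gap_antimono[of 0 w] hazard_gt[of w] w0 by (intro mult_left_mono) (auto simp: hazard_0)
      finally have 1: "1 / (2 * kap + w) \<le> hazard w - w"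
        using w0 by (simp add: pos_divide_le_eq add_pos_pos)
      have "kap \<le> 1 / kap" using inverse_kap_sq(1) by (simp add: field_simps)
      then have "2 * kap \<le> 2 * (1 / kap)" by (rule mult_left_mono) simp
      then have "2 * kap + w \<le> 2 * (1 / kap + w)" unfolding distrib_left using w0 by linarith
      also have "\<dots> \<le> 2 * N (w + s)"
        using N_ge_linear[of w] N_mono[of w "w + s"] w0 s by simp
      finally have "1 / (2 * N (w + s)) \<le> 1 / (2 * kap + w)"
        using w0 by (intro divide_left_mono) (auto intro!: mult_pos_pos add_pos_pos)
      with 1 have "b * (1 / (2 * N (w + s))) \<le> b * (hazard w - w)" using b by (intro mult_left_mono) auto
      then have "b / (2 * N (w + s)) \<le> 1 - w * b" using b by (simp add: algebra_simps)
      moreover have "w * b * (b / (2 * N (w + s))) \<le> 1 * (b / (2 * N (w + s)))"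
        using wb(2) b by (intro mult_right_mono) auto
      ultimately show "w * b * (hazard w * b) + w * b * (b / (2 * N (w + s))) \<le> 1" using b by simp
    qed (use w0 in simp)
    finally show ?thesis using zt by simp
  qed
  show "hazard w * (1 - t)\<^sup>2 \<le> w + implied_rate s w * (1 - t / 2)" if "1 \<le> t"
  proof -
    define p where "p = t - 1"
    have p: "0 \<le> p" "p \<le> kap * w" "p \<le> (5709 / 10000)" using that t(2,3) inverse_kap_sq by (simp_all add: p_def)
    have h: "hazard w \<le> w + kap" using hazard_le[of w] w0 by simp
    have "(w + kap) * (p * p) \<le> w"
    proof (cases "w \<le> 1")
      case True
      have "p * p \<le> (kap * w) * (5709 / 10000)" using p by (intro mult_mono) auto
      then have "(w + kap) * (p * p) \<le> (w + kap) * ((kap * w) * (5709 / 10000))"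
        using w0 by (intro mult_left_mono) auto
      also have "\<dots> = w * ((5709 / 10000) * (kap * (w + kap)))" by (simp add: algebra_simps)
      also have "kap * (w + kap) \<le> 798 / 1000 * (1798 / 1000)"
        using True kap_bounds w0 by (intro mult_mono) auto
      then have "w * ((5709 / 10000) * (kap * (w + kap))) \<le> w * 1"
        using w0 by (intro mult_left_mono) auto
      finally show ?thesis by simp
    next
      case False
      have "p * p \<le> (5709 / 10000) * (5709 / 10000)" using p by (intro mult_mono) auto
      then have "(w + kap) * (p * p) \<le> (w + kap) * ((5709 / 10000) * (5709 / 10000))"
        using w0 by (intro mult_left_mono) auto
      also have "\<dots> \<le> w" using False kap_bounds by (simp add: field_simps)
      finally show ?thesis .
    qed
    moreover have "hazard w * (p * p) \<le> (w + kap) * (p * p)" using h by (intro mult_right_mono) auto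
    ultimately have "hazard w * (p * p) \<le> w + implied_rate s w * (1 - t / 2)" using zt by linarith
    then show ?thesis by (simp add: p_def power2_eq_square algebra_simps)
  qed
qed

section \<open>Thresholds between zero and the scale\<close>

lemma phi_gauss: "phi x = kap / 2 * exp (- x\<^sup>2 / 2)"
proof -
  have "kap / 2 = 1 / sqrt (2 * pi)" using phi_0 by (simp add: std_normal_density_def)
  then show ?thesis by (simp only: std_normal_density_def)
qed

text \<open>Here \<open>s z = x\<^sup>2 + 2 ln H\<close>, where \<open>H\<close> is the harmonic mean of \<open>hazard x / kap\<close> and \<open>hazard w / kap\<close>. The
  estimate from above replaces it by the arithmetic mean.\<close>

lemma implied_rate_bounds_low_threshold:
  assumes w: "0 \<le> w" "w < s"
  defines "x \<equiv> s - w"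
  shows "implied_rate s w \<le> x + 1 / kap"
    "x\<^sup>2 + kap * x / (1 + kap * x) + kap * w / (1 + kap * w) \<le> s * implied_rate s w"
proof -
  define P where "P = hazard x"
  define L where "L = hazard w"
  have x: "0 < x" and s: "0 < s" using w by (simp_all add: x_def)
  have P: "0 < P" "0 < L" by (simp_all add: P_def L_def)
  have a: "N (w - s) = 1 / P" "N (- w) = 1 / L" by (simp_all add: P_def L_def hazard_def x_def)
  have pn: "phi (w - s) * (N (w - s) + N (s - w)) = 1" using phi_N_sum[of "w - s"] by simp
  have "phi (w - s) = kap / 2 * exp (- x\<^sup>2 / 2)" by (simp add: phi_gauss x_def power2_commute)
  with pn have "kap / 2 * exp (- x\<^sup>2 / 2) * (N (w - s) + N (s - w)) = 1" by simp
  then have "kap * (N (w - s) + N (s - w)) = 2 * exp (x\<^sup>2 / 2)"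
    by (simp add: exp_minus field_simps)
  have m_eq: "kap / P + kap / L = kap * (1 / P + 1 / L)" by (simp add: distrib_left)
  from \<open>kap * (N (w - s) + N (s - w)) = 2 * exp (x\<^sup>2 / 2)\<close>
  have "N (w - s) + N (s - w) = exp (x\<^sup>2 / 2) * (2 / kap)"
    by (simp add: field_simps)
  then have "(N (w - s) + N (s - w)) / (N (w - s) + N (- w)) = exp (x\<^sup>2 / 2) * (2 / (kap / P + kap / L))"
    unfolding a by (simp add: m_eq)
  then have "s * implied_rate s w = 2 * ln (exp (x\<^sup>2 / 2) * (2 / (kap / P + kap / L)))"
    using implied_rate_log[of s w] s by simp
  also have "\<dots> = 2 * (x\<^sup>2 / 2 + ln (2 / (kap / P + kap / L)))"
    using P by (subst ln_mult_pos) (auto intro!: divide_pos_pos add_pos_pos)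
  finally have z: "s * implied_rate s w = x\<^sup>2 + 2 * ln (2 / (kap / P + kap / L))" by simp
  define m where "m = kap / P + kap / L"
  have m: "m > 0" using P by (simp add: m_def add_pos_pos)
  \<comment> \<open>The harmonic mean is at most the arithmetic mean.\<close>
  have "2 / m \<le> (P / kap + L / kap) / 2"
  proof -
    have "0 \<le> (P - L)\<^sup>2" by simp
    then have "4 * (P * L) \<le> (P + L) * (P + L)" by (simp add: power2_eq_square algebra_simps)
    then have "2 * (P * L) / (P + L) \<le> (P + L) / 2" using P by (simp add: pos_divide_le_eq)
    then have "2 * (P * L) / (P + L) / kap \<le> (P + L) / 2 / kap" by (rule divide_right_mono) simp
    moreover have "2 / m = 2 * (P * L) / (P + L) / kap"
      using P unfolding m_def m_eq by (simp add: add_frac_eq add.commute mult_ac)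
    ultimately show ?thesis by (simp add: add_divide_distrib)
  qed
  also have "\<dots> \<le> ((x + kap) / kap + (w + kap) / kap) / 2"
    using hazard_le[of x] hazard_le[of w] x w by (intro divide_right_mono add_mono) (auto simp: P_def L_def)
  also have "\<dots> = s / (2 * kap) + 1" by (simp add: x_def field_simps)
  finally have "ln (2 / m) \<le> s / (2 * kap)"
    using ln_le_minus_one[of "2 / m"] m by simp
  then have "s * implied_rate s w \<le> x\<^sup>2 + s / kap" unfolding z m_def by simp
  also have "x\<^sup>2 \<le> s * x" using x w by (simp add: x_def power2_eq_square)
  finally have "s * implied_rate s w \<le> s * (x + 1 / kap)" by (simp add: distrib_left)
  then show "implied_rate s w \<le> x + 1 / kap" using s by (rule mult_left_le_imp_le)

  have "ln (m / 2) \<le> m / 2 - 1" using m by (intro ln_le_minus_one) simp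
  moreover have "ln (m / 2) = ln m - ln 2" "ln (2 / m) = ln 2 - ln m" using m by (simp_all add: ln_div)
  ultimately have "2 * ln (2 / m) \<ge> 2 - m" by linarith
  then have lower: "2 * ln (2 / m) \<ge> (1 - kap / P) + (1 - kap / L)"
    unfolding m_def by simp
  have aux: "kap * y / (1 + kap * y) \<le> 1 - kap / hazard y" if "0 \<le> y" for y
  proof -
    have p: "0 < 1 + kap * y" using that by (simp add: add_pos_nonneg)
    have "kap / hazard y \<le> kap / (kap * (1 + kap * y))"
      using hazard_ge_tangent_0[OF that] p by (intro divide_left_mono mult_pos_pos) (auto simp: algebra_simps)
    also have "\<dots> = 1 / (1 + kap * y)" by simp
    also have "\<dots> = 1 - kap * y / (1 + kap * y)" using p by (simp add: field_simps)
    finally show ?thesis by simp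
  qed
  show "x\<^sup>2 + kap * x / (1 + kap * x) + kap * w / (1 + kap * w) \<le> s * implied_rate s w"
    using aux[of x] aux[of w] x w(1) lower unfolding z m_def P_def L_def by simp
qed

text \<open>The bound \<open>C * P \<le> Z * (P + 2 * w + C)\<close> needed below, for the largest possible \<open>P\<close> and a lower bound of \<open>Z\<close>, in the variables
  \<open>a = kap * x\<close> and \<open>b = kap * w\<close> with denominators cleared; there \<open>k = kap\<^sup>2 = 2 / pi\<close> and \<open>c = 1 / k\<close>.
  Every coefficient of the difference as a polynomial in \<open>a\<close> is nonnegative; the tight case is
  \<open>2 - 3 * k > 0\<close>.\<close>

lemma polynomial_low_threshold:
  fixes a b k c :: real
  assumes ab: "0 \<le> a" "0 \<le> b" and k: "6366 / 10000 < k" "k < 6367 / 10000" and ck: "c * k = 1"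
  shows "(3 + 2 * b) * (a + k) * (a + b) * (1 + a) * (1 + b)
    \<le> (c * a\<^sup>2 * (1 + a) * (1 + b) + a * (1 + b) + b * (1 + a)) * ((a + 2 * b) * (1 + b) + k * (4 + 3 * b))"
proof -
  have c: "157 / 100 < c"
  proof (rule ccontr)
    assume "\<not> 157 / 100 < c"
    then have "c * k \<le> 157 / 100 * k" using k by (intro mult_right_mono) auto
    with ck k show False by simp
  qed
  define u where "u = 1 + b"
  define r where "r = 2 * b * u + k * (4 + 3 * b)"
  define d where "d = 3 + 2 * b"
  have u: "u > 0" using ab by (simp add: u_def)
  have cr: "c * r = 2 * (c * (b * u)) + (4 + 3 * b)"
  proof -
    have "c * r = 2 * (c * (b * u)) + (c * k) * (4 + 3 * b)"
      by (simp add: r_def algebra_simps)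
    then show ?thesis by (simp add: ck)
  qed
  have cb: "157 / 100 * (b * u) \<le> c * (b * u)" using c ab u by (intro mult_right_mono) auto
  have kb: "k * b \<le> 6367 / 10000 * b" "k * b\<^sup>2 \<le> 6367 / 10000 * b\<^sup>2" "k * b ^ 3 \<le> 6367 / 10000 * b ^ 3"
    using k ab by (intro mult_right_mono; simp)+
  have nn: "0 \<le> b" "0 \<le> b\<^sup>2" "0 \<le> b ^ 3" "0 \<le> k * b" "0 \<le> k * b\<^sup>2" using ab k by auto
  have c0: "0 \<le> b * r - d * u * k * b"
  proof -
    have "b * r - d * u * k * b = b * (2 * b + 2 * b\<^sup>2 + k - 2 * (k * b) - 2 * (k * b\<^sup>2))"
      by (simp add: r_def d_def u_def algebra_simps power2_eq_square)
    also have "\<dots> \<ge> 0"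
    proof (rule mult_nonneg_nonneg)
      show "0 \<le> 2 * b + 2 * b\<^sup>2 + k - 2 * (k * b) - 2 * (k * b\<^sup>2)"
        using nn kb k by linarith
    qed fact
    finally show ?thesis .
  qed
  have c1: "0 \<le> (1 + 2 * b) * r + b * u - d * u * (k + b + k * b)"
  proof -
    have "(1 + 2 * b) * r + b * u - d * u * (k + b + k * b)
      = k + 3 * (k * b) + 2 * b\<^sup>2 - k * b\<^sup>2 + 2 * b ^ 3 - 2 * (k * b ^ 3)"
      by (simp add: r_def d_def u_def algebra_simps power2_eq_square power3_eq_cube)
    also have "\<dots> \<ge> 0" using nn kb k by linarith
    finally show ?thesis .
  qed
  have c2: "0 \<le> (1 + 2 * b) + c * r - d * (1 + k + b)"
  proof -
    have "d * (1 + k + b) = 3 + 3 * k + 5 * b + 2 * (k * b) + 2 * b\<^sup>2"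
      by (simp add: d_def algebra_simps power2_eq_square)
    moreover have "157 / 100 * b + 157 / 100 * b\<^sup>2 \<le> c * (b * u)" using cb by (simp add: u_def algebra_simps power2_eq_square)
    ultimately show ?thesis using nn kb k cr by linarith
  qed
  have c3: "0 \<le> c * u + c * r - d"
  proof -
    have "0 \<le> c * u" "0 \<le> c * (b * u)" using c u ab by auto
    then show ?thesis using cr ab by (simp add: d_def)
  qed
  have "(c * a\<^sup>2 * (1 + a) * u + a * u + b * (1 + a)) * ((a + 2 * b) * u + k * (4 + 3 * b))
      - d * (a + k) * (a + b) * (1 + a) * u
    = (b * r - d * u * k * b) + a * ((1 + 2 * b) * r + b * u - d * u * (k + b + k * b))
      + a\<^sup>2 * u * ((1 + 2 * b) + c * r - d * (1 + k + b)) + a ^ 3 * u * (c * u + c * r - d) + a ^ 4 * c * u\<^sup>2"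
  proof -
    have L: "c * a\<^sup>2 * (1 + a) * u + a * u + b * (1 + a) = b + a * (1 + 2 * b) + c * a\<^sup>2 * (1 + a) * u"
      by (simp add: u_def algebra_simps)
    have R: "(a + 2 * b) * u + k * (4 + 3 * b) = a * u + r" by (simp add: r_def algebra_simps)
    show ?thesis
      unfolding L R by (simp add: algebra_simps power2_eq_square power3_eq_cube power4_eq_xxxx)
  qed
  also have "\<dots> \<ge> 0"
    using ab u c by (intro add_nonneg_nonneg mult_nonneg_nonneg zero_le_power c0 c1 c2 c3) auto
  finally show ?thesis by (simp add: u_def d_def)
qed

text \<open>With \<open>P = 1 / N (w - s)\<close> and \<open>z = P * t\<close>, both inequalities bound \<open>(1 - t)\<^sup>2\<close> by a quotient with numerator
  \<open>P + 2 * w\<close>. For \<open>t \<ge> 1\<close> the bound \<open>t \<le> pi / 2\<close> is enough. For \<open>t \<le> 1\<close> the square is replaced by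
  \<open>1 - t\<close>, which makes the claim linear in \<open>t\<close>.\<close>

lemma premises_low_threshold:
  fixes s w defines "t \<equiv> N (w - s) * implied_rate s w"
  assumes w: "0 \<le> w" "w < s" and z: "0 < implied_rate s w"
  shows "t \<le> 2"
    "t \<le> 1 \<Longrightarrow> (hazard w + 1 / (2 * N (w + s))) * (1 - t)\<^sup>2 \<le> w + implied_rate s w * (1 - t / 2)"
    "1 \<le> t \<Longrightarrow> hazard w * (1 - t)\<^sup>2 \<le> w + implied_rate s w * (1 - t / 2)"
proof -
  define x where "x = s - w"
  define P where "P = hazard x"
  define Z where "Z = implied_rate s w"
  have x: "0 < x" and s: "0 < s" and sx: "s = x + w" using w by (simp_all add: x_def)
  have P: "0 < P" "kap \<le> P" "P \<le> x + kap" "kap * (1 + kap * x) \<le> P"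
    using hazard_mono[of 0 x] hazard_le[of x] hazard_ge_tangent_0[of x] x
    by (simp_all add: P_def hazard_0 algebra_simps)
  have h: "hazard w \<le> w + kap" using hazard_le[of w] w by simp
  have t: "t = Z / P" by (simp add: t_def P_def Z_def hazard_def x_def)
  have Zt: "Z = P * t" using P by (simp add: t)
  have zb: "Z \<le> x + 1 / kap" "x\<^sup>2 + kap * x / (1 + kap * x) + kap * w / (1 + kap * w) \<le> s * Z"
    using implied_rate_bounds_low_threshold[OF w] by (simp_all add: Z_def x_def)
  have t0: "0 < t" using z P by (simp add: t Z_def)
  have "Z \<le> (1 / (kap * kap)) * (kap * (1 + kap * x))"
  proof -
    have "1 / (kap * kap) * (kap * (1 + kap * x)) = x + 1 / kap" by (simp add: field_simps)
    with zb(1) show ?thesis by simp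
  qed
  also have "\<dots> \<le> (1 / (kap * kap)) * P" using P by (intro mult_left_mono) auto
  finally have "t \<le> 1 / (kap * kap)" using P by (simp add: t field_simps)
  then have tup: "t \<le> 15709 / 10000" using inverse_kap_sq by simp
  then show "t \<le> 2" by simp
  have eq: "Z * (1 - t / 2) = P / 2 - P / 2 * (1 - t)\<^sup>2"
    by (simp add: Zt power2_eq_square field_simps)

  show "hazard w * (1 - t)\<^sup>2 \<le> w + implied_rate s w * (1 - t / 2)" if "1 \<le> t"
  proof -
    have "(t - 1) * (t - 1) \<le> 5709 / 10000 * (5709 / 10000)" using that tup by (intro mult_mono) auto
    then have sq: "(1 - t)\<^sup>2 \<le> 33 / 100" by (simp add: power2_eq_square algebra_simps)
    have "(hazard w + P / 2) * (1 - t)\<^sup>2 \<le> (w + P + P / 2) * (33 / 100)"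
      using sq h P w by (intro mult_mono) auto
    also have "\<dots> \<le> w + P / 2" using w P by simp
    finally show ?thesis using eq by (simp add: Z_def algebra_simps)
  qed

  show "(hazard w + 1 / (2 * N (w + s))) * (1 - t)\<^sup>2 \<le> w + implied_rate s w * (1 - t / 2)" if "t \<le> 1"
  proof -
    define C where "C = kap * (2 + 1 / (1 + kap * w))"
    have kw: "0 < 1 + kap * w" "0 < 1 + kap * x" using w x by (simp_all add: add_pos_nonneg)
    have C: "C > 0" using kw by (simp add: C_def add_pos_pos)
    have "1 / N (w + s) \<le> 1 / ((1 + kap * w) / kap)"
      using N_ge_linear[of w] N_mono[of w "w + s"] w s kw
      by (intro divide_left_mono) (auto simp: add_divide_distrib intro!: mult_pos_pos divide_pos_pos add_pos_nonneg)
    then have lam: "2 * hazard w + 1 / N (w + s) \<le> 2 * w + C"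
      using h by (simp add: C_def algebra_simps)
    have "C * P \<le> Z * (P + 2 * w + C)"
    proof (cases "C \<le> Z")
      case True
      have "C * P \<le> Z * P" using True P by (intro mult_right_mono) auto
      also have "\<dots> \<le> Z * (P + 2 * w + C)" using z w C by (intro mult_left_mono) (auto simp: Z_def)
      finally show ?thesis .
    next
      case False
      define a where "a = kap * x"
      define b where "b = kap * w"
      define k where "k = kap * kap"
      have ab: "0 \<le> a" "0 \<le> b" "0 < 1 + a" "0 < 1 + b" "0 < k"
        using w x kw by (simp_all add: a_def b_def k_def)
      have key: "(3 + 2 * b) * (a + k) * (a + b) * (1 + a) * (1 + b)
        \<le> (1 / k * a\<^sup>2 * (1 + a) * (1 + b) + a * (1 + b) + b * (1 + a)) * ((a + 2 * b) * (1 + b) + k * (4 + 3 * b))"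
        using ab two_div_pi_bounds by (intro polynomial_low_threshold) (auto simp: k_def kap_sq)
      have sq: "x\<^sup>2 = 1 / k * a\<^sup>2" by (simp add: a_def k_def power2_eq_square)
      have A: "(x\<^sup>2 + a / (1 + a) + b / (1 + b)) * ((1 + a) * (1 + b))
          = 1 / k * a\<^sup>2 * (1 + a) * (1 + b) + a * (1 + b) + b * (1 + a)"
      proof -
        have "a / (1 + a) * ((1 + a) * (1 + b)) = a * (1 + b)" "b / (1 + b) * ((1 + a) * (1 + b)) = b * (1 + a)"
          using ab by auto
        then show ?thesis
          unfolding sq distrib_right[of _ _ "(1 + a) * (1 + b)"] by (simp only: mult.assoc)
      qed
      have kC: "kap * ((1 + b) * C) = k * (3 + 2 * b)"
      proof -
        have "(1 + b) * (2 + 1 / (1 + b)) = 3 + 2 * b" using ab(4) by (simp add: distrib_left)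
        then show ?thesis unfolding C_def b_def[symmetric] k_def by (simp add: mult_ac)
      qed
      have kx: "kap * (x + kap) = a + k" "kap * s = a + b" "kap * (x + kap + 2 * w) = a + k + 2 * b"
        by (simp_all add: a_def b_def k_def sx algebra_simps)
      have "kap * (1 + b) * (x + kap + 2 * w + C) = (1 + b) * (kap * (x + kap + 2 * w)) + kap * ((1 + b) * C)"
        by (simp add: algebra_simps)
      also have "\<dots> = (a + 2 * b) * (1 + b) + k * (4 + 3 * b)"
        unfolding kC kx by (simp add: algebra_simps)
      finally have B: "kap * (1 + b) * (x + kap + 2 * w + C) = (a + 2 * b) * (1 + b) + k * (4 + 3 * b)" .
      have "C * (x + kap) * s \<le> (x\<^sup>2 + a / (1 + a) + b / (1 + b)) * (x + kap + 2 * w + C)"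
      proof -
        have "(kap * (1 + b) * k * ((1 + a) * (1 + b))) * (C * (x + kap) * s)
          = (1 + a) * (1 + b) * (kap * ((1 + b) * C)) * (kap * (x + kap)) * (kap * s)"
          by (simp add: k_def mult_ac)
        also have "\<dots> = k * ((3 + 2 * b) * (a + k) * (a + b) * (1 + a) * (1 + b))"
          unfolding kC kx by (simp add: mult_ac)
        also have "\<dots> \<le> k * ((1 / k * a\<^sup>2 * (1 + a) * (1 + b) + a * (1 + b) + b * (1 + a)) *
            ((a + 2 * b) * (1 + b) + k * (4 + 3 * b)))"
          using key ab by (intro mult_left_mono) auto
        also have "\<dots> = (kap * (1 + b) * k * ((1 + a) * (1 + b))) *
            ((x\<^sup>2 + a / (1 + a) + b / (1 + b)) * (x + kap + 2 * w + C))"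
          unfolding A[symmetric] B[symmetric] by (simp only: mult_ac)
        finally show ?thesis
          by (rule mult_left_le_imp_le) (use ab in simp)
      qed
      also have "\<dots> \<le> s * Z * (x + kap + 2 * w + C)"
        using zb(2) x w C by (intro mult_right_mono) (auto simp: a_def b_def)
      finally have "s * (C * (x + kap)) \<le> s * (Z * (x + kap + 2 * w + C))" by (simp add: mult_ac)
      then have 1: "C * (x + kap) \<le> Z * (x + kap + 2 * w + C)"
        using s by (rule mult_left_le_imp_le)
      have "0 \<le> (C - Z) * (x + kap - P)" using False P by (intro mult_nonneg_nonneg) auto
      with 1 show ?thesis by (simp add: algebra_simps)
    qed
    then have "C \<le> t * (P + 2 * w + C)" using P by (simp add: t field_simps)
    then have "(1 - t) * (P + 2 * w + C) \<le> P + 2 * w" by (simp add: algebra_simps)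
    \<comment> \<open>One factor \<open>1 - t\<close> is at most 1.\<close>
    then have "(1 - t) * ((1 - t) * (P + 2 * w + C)) \<le> 1 * (P + 2 * w)"
      using that t0 P w C by (intro mult_mono) auto
    then have "(P + 2 * w + C) * (1 - t)\<^sup>2 \<le> P + 2 * w" by (simp add: power2_eq_square mult_ac)
    moreover have "(2 * hazard w + 1 / N (w + s) + P) * (1 - t)\<^sup>2 \<le> (P + 2 * w + C) * (1 - t)\<^sup>2"
      using lam by (intro mult_right_mono) auto
    moreover have "(2 * hazard w + 1 / N (w + s) + P) * (1 - t)\<^sup>2
        = 2 * ((hazard w + 1 / (2 * N (w + s))) * (1 - t)\<^sup>2 + P / 2 * (1 - t)\<^sup>2)"
      by (simp add: field_simps)
    ultimately show ?thesis using eq by (simp add: Z_def)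
  qed
qed

section \<open>Negative thresholds\<close>

lemma I1_mono: "x \<le> y \<Longrightarrow> I1 x \<le> I1 y"
proof (rule DERIV_nonneg_imp_nondecreasing[of x y I1])
  show "\<exists>d. (I1 has_real_derivative d) (at u) \<and> 0 \<le> d" for u
    using DERIV_I1[of u] Phi_pos[of u] less_imp_le by blast
qed

lemma exp_neg_half_sq_le: "exp (- y\<^sup>2 / 2) \<le> 1 / (1 + y\<^sup>2 / 2 + y ^ 4 / 8)" for y :: real
proof -
  have "1 + y\<^sup>2 / 2 + (y\<^sup>2 / 2)\<^sup>2 / 2 \<le> exp (y\<^sup>2 / 2)"
    by (rule exp_lower_Taylor_quadratic) simp
  then have "1 + y\<^sup>2 / 2 + y ^ 4 / 8 \<le> exp (y\<^sup>2 / 2)"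
    by (simp add: power2_eq_square power4_eq_xxxx)
  then have "1 / exp (y\<^sup>2 / 2) \<le> 1 / (1 + y\<^sup>2 / 2 + y ^ 4 / 8)"
    by (intro divide_left_mono) (auto intro!: mult_pos_pos add_pos_nonneg)
  then show ?thesis by (simp add: exp_minus inverse_eq_divide)
qed

text \<open>The linear bound is the tangent at \<open>y = 5 / 6\<close> to the curve \<open>m = (sqrt (y\<^sup>2 + 4) - y) / 2\<close>, on which the
  slope \<open>h (h - y)\<close> for \<open>h = 1 / m\<close> equals 1.\<close>

lemma N_minus_ge:
  assumes "0 \<le> y" "y \<le> 1"
  shows "(12 - 4 * y) / 13 \<le> N (- y)"
proof -
  have h: "hazard y \<le> 13 / (12 - 4 * y)"
  proof (rule ccontr)
    assume "\<not> hazard y \<le> 13 / (12 - 4 * y)"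
    moreover have "y \<le> 13 / (12 - 4 * y)"
    proof -
      have "0 \<le> (3 - 2 * y)\<^sup>2" by simp
      then have "y * (12 - 4 * y) \<le> 13" by (simp add: power2_eq_square algebra_simps)
      then show ?thesis using assms by (simp add: pos_le_divide_eq)
    qed
    ultimately have "13 / (12 - 4 * y) * (13 / (12 - 4 * y) - y) \<le> hazard y * (hazard y - y)"
      using assms by (intro mult_mono) auto
    moreover have "1 \<le> 13 / (12 - 4 * y) * (13 / (12 - 4 * y) - y)"
    proof -
      have "0 \<le> (5 - 6 * y)\<^sup>2" by simp
      then have "(12 - 4 * y) * (12 - 4 * y) \<le> 13 * (13 - y * (12 - 4 * y))"
        by (simp add: power2_eq_square algebra_simps)
      moreover have "t * (t - y) = u * (u - y * d) / (d * d)" if "d \<noteq> 0" "t = u / d" for t u d :: real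
      proof -
        have "u / d - y = (u - y * d) / d" using that(1) by (simp add: diff_divide_distrib)
        then show ?thesis unfolding that(2) by simp
      qed
      from this[of "12 - 4 * y" "13 / (12 - 4 * y)" 13]
      have "13 / (12 - 4 * y) * (13 / (12 - 4 * y) - y)
          = 13 * (13 - y * (12 - 4 * y)) / ((12 - 4 * y) * (12 - 4 * y))"
        using assms by simp
      ultimately show ?thesis using assms by (simp add: pos_le_divide_eq)
    qed
    ultimately show False using hazard_slope_less_1[of y] by linarith
  qed
  have "N (- y) = 1 / hazard y" by (simp add: hazard_def)
  also have "\<dots> \<ge> 1 / (13 / (12 - 4 * y))" using h assms by (intro divide_left_mono) auto
  finally show ?thesis by simp
qed

text \<open>By Jensen's inequality \<open>2 * I1 (- y)\<close> bounds the excess of \<open>z\<close> over \<open>s + 2 * y\<close>. A linear bound is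
  wanted because it is compared with the tangents below the hazard rate.\<close>

lemma I1_minus_le:
  assumes y: "0 \<le> y" "y \<le> 95 / 100"
  shows "2 * I1 (- y) \<le> 8 / 10 - 62 / 100 * y"
proof -
  define d where "d = 1 + y\<^sup>2 / 2 + y ^ 4 / 8"
  have d: "d > 0" by (simp add: d_def add_pos_nonneg)
  have "N1 (- y) = 1 - y * N (- y)" by (simp add: N1_def)
  also have "\<dots> \<le> 1 - y * ((12 - 4 * y) / 13)"
    using N_minus_ge[of y] y by (intro diff_left_mono mult_left_mono) auto
  finally have n: "N1 (- y) \<le> (13 - 12 * y + 4 * y\<^sup>2) / 13" by (simp add: field_simps power2_eq_square)
  have q: "0 \<le> 13 - 12 * y + 4 * y\<^sup>2"
    using zero_le_power2[of "2 * y - 3"] by (simp add: power2_eq_square algebra_simps)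
  have "2 * I1 (- y) = kap * exp (- y\<^sup>2 / 2) * N1 (- y)"
    by (simp add: I1_eq phi_gauss)
  also have "\<dots> \<le> 798 / 1000 * (1 / d) * ((13 - 12 * y + 4 * y\<^sup>2) / 13)"
    using kap_bounds exp_neg_half_sq_le[of y] n d unfolding d_def[symmetric]
    by (intro mult_mono) (auto intro: less_imp_le)
  also have "\<dots> = 798 / 13000 * (13 - 12 * y + 4 * y\<^sup>2) / d" by simp
  also have "\<dots> \<le> 8 / 10 - 62 / 100 * y"
  proof -
    \<comment> \<open>The quintic inequality below follows linearly from the signs of these four products.\<close>
    define q2 q3 q4 q5 where "q2 = y * y" "q3 = y * q2" "q4 = y * q3" "q5 = y * q4"
    note q = q2_q3_q4_q5_def
    have "0 \<le> y * (y * (y - 9 / 10)\<^sup>2)" "0 \<le> y * (y * (95 / 100 - y))" "0 \<le> y * (95 / 100 - y)"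
      "0 \<le> y * (y ^ 3 * (95 / 100 - y))"
      using y by (auto intro!: mult_nonneg_nonneg)
    then have F: "0 \<le> q4 - 18 / 10 * q3 + 81 / 100 * q2" "0 \<le> 95 / 100 * q2 - q3" "0 \<le> 95 / 100 * y - q2"
      "0 \<le> 95 / 100 * q4 - q5"
      by (simp_all add: q power2_eq_square power3_eq_cube algebra_simps)
    have "(8 / 10 - 62 / 100 * y) * d
        = 8 / 10 - 62 / 100 * y + 4 / 10 * q2 - 31 / 100 * q3 + 1 / 10 * q4 - 775 / 10000 * q5"
      unfolding d_def by (simp add: q power2_eq_square power4_eq_xxxx algebra_simps)
    moreover have "798 / 13000 * (13 - 12 * y + 4 * y\<^sup>2) = 798 / 1000 - 9576 / 13000 * y + 3192 / 13000 * q2"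
      by (simp add: q power2_eq_square field_simps)
    ultimately have "798 / 13000 * (13 - 12 * y + 4 * y\<^sup>2) \<le> (8 / 10 - 62 / 100 * y) * d"
      using F y by linarith
    then show ?thesis using d by (simp add: pos_divide_le_eq)
  qed
  finally show ?thesis .
qed

lemma I1_minus_le_const: "95 / 100 \<le> y \<Longrightarrow> 2 * I1 (- y) \<le> 211 / 1000"
  using I1_mono[of "- y" "- (95 / 100)"] I1_minus_le[of "95 / 100"] by simp

text \<open>At \<open>y = 0\<close> both sides agree; \<open>exp x \<ge> 1 + x\<close> settles \<open>y \<le> 2\<close>.\<close>

lemma phi_ge: "kap \<le> y + 2 * phi y" if "0 \<le> y"
proof (cases "y \<le> 2")
  case True
  have "1 + - y\<^sup>2 / 2 \<le> exp (- y\<^sup>2 / 2)" by (rule exp_ge_add_one_self)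
  then have "kap * (1 - y\<^sup>2 / 2) \<le> kap * exp (- y\<^sup>2 / 2)" by (intro mult_left_mono) auto
  moreover have "y * y \<le> y * 2" using True that by (intro mult_left_mono)
  then have "kap * (y\<^sup>2 / 2) \<le> 1 * y"
    using kap_bounds that unfolding power2_eq_square by (intro mult_mono) auto
  ultimately show ?thesis by (simp add: phi_gauss algebra_simps)
next
  case False
  then show ?thesis using kap_bounds phi_pos[of y] by linarith
qed

text \<open>For the threshold \<open>w = - y\<close> the number \<open>c = z - s - 2 * y\<close> is twice \<open>- ln (scaled_mean s w) / s\<close>, and
  \<open>1 - x / P\<close> is \<open>N1 (w - s)\<close>.\<close>

lemma bounds_negative_threshold:
  fixes s y defines "x \<equiv> s + y" and "P \<equiv> hazard (s + y)" and "c \<equiv> implied_rate s (- y) - s - 2 * y"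
  assumes s: "0 < s" and y: "0 \<le> y"
  shows "N (- y - s) = 1 / P" "0 < P" "x \<le> P" "(4 + 5 * x) / 6 \<le> P" "P \<le> x + kap"
    "2 * phi y * (1 - x / P) \<le> c" "c \<le> 2 * I1 (- y)" "kap * (1 - x / P) \<le> y + c"
    "hazard (- y) \<le> kap" "0 \<le> c" "0 \<le> 1 - x / P"
proof -
  have x: "0 \<le> x" using s y by (simp add: x_def)
  have "- y - s = - (s + y)" by simp
  then show a: "N (- y - s) = 1 / P" by (simp only: P_def hazard_def) simp
  show P: "0 < P" "x \<le> P" "(4 + 5 * x) / 6 \<le> P" "P \<le> x + kap"
    using hazard_gt[of x] hazard_ge_1[OF x] hazard_le[OF x] by (simp_all add: P_def x_def)
  have "N1 (- y - s) = 1 + (- x) * (1 / P)" by (simp add: N1_def a x_def)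
  then have e: "N1 (- y - s) = 1 - x / P" by simp
  show e0: "0 \<le> 1 - x / P" using P by simp
  show c1: "2 * phi y * (1 - x / P) \<le> c"
    using implied_rate_ge[OF s, of "- y"] by (simp add: e c_def)
  show "c \<le> 2 * I1 (- y)" using implied_rate_le[OF s, of "- y"] by (simp add: c_def)
  have "0 \<le> 2 * phi y * (1 - x / P)" using e0 by (intro mult_nonneg_nonneg) simp_all
  also note c1
  finally show "0 \<le> c" .
  have "kap * (1 - x / P) \<le> (y + 2 * phi y) * (1 - x / P)"
    using phi_ge[OF y] e0 by (rule mult_right_mono)
  also have "\<dots> \<le> y * 1 + 2 * phi y * (1 - x / P)"
    unfolding distrib_right using y P x by (intro add_mono mult_left_mono) auto
  finally show "kap * (1 - x / P) \<le> y + c" using c1 by simp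
  show "hazard (- y) \<le> kap" using hazard_mono[of "- y" 0] y by (simp add: hazard_0)
qed

text \<open>For \<open>t \<ge> 1\<close> the bound \<open>t \<le> 7 / 5\<close> suffices, since \<open>P\<close> exceeds \<open>3 * y\<close>. For \<open>t \<le> 1\<close> the number
  \<open>1 - t\<close> is at most \<open>e (1 - g)\<close> with \<open>e \<le> g = kap / P\<close>, and \<open>g (1 - g) \<le> 1 / 4\<close>.\<close>

lemma premises_large_scale:
  fixes s y defines "t \<equiv> N (- y - s) * implied_rate s (- y)"
  assumes s: "0 < s" and y: "0 \<le> y" "2 * y \<le> s"
  shows "t \<le> 2"
    "t \<le> 1 \<Longrightarrow> (hazard (- y) + 1 / (2 * N (- y + s))) * (1 - t)\<^sup>2 \<le> - y + implied_rate s (- y) * (1 - t / 2)"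
    "1 \<le> t \<Longrightarrow> hazard (- y) * (1 - t)\<^sup>2 \<le> - y + implied_rate s (- y) * (1 - t / 2)"
proof -
  define x where "x = s + y"
  define P where "P = hazard (s + y)"
  define c where "c = implied_rate s (- y) - s - 2 * y"
  define e where "e = 1 - x / P"
  define l where "l = hazard (- y)"
  note nb = bounds_negative_threshold[OF s y(1), folded P_def, folded x_def, folded c_def, folded e_def, folded l_def]
  have l0: "0 \<le> l" by (simp add: l_def)
  have z: "implied_rate s (- y) = s + 2 * y + c" by (simp add: c_def)
  have t: "t * P = s + 2 * y + c" using nb(1,2) by (simp add: t_def z)
  have tz: "s + 2 * y + c = P * t" using t by (simp add: mult.commute)
  have e1: "e \<le> 1" using nb(2) s y by (simp add: e_def x_def)
  have eP: "e * P = P - x" using nb(2) by (simp add: e_def left_diff_distrib)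
  \<comment> \<open>For small \<open>y\<close> the tangent at 1 is the better lower bound of \<open>P\<close>, for large \<open>y\<close> it is \<open>x\<close>.\<close>
  have tup: "t \<le> 14 / 10"
  proof -
    have "s + 2 * y + c \<le> 14 / 10 * P"
    proof (cases "y \<le> 95 / 100")
      case True
      then have "c \<le> 8 / 10 - 62 / 100 * y" using I1_minus_le[OF y(1)] nb(7) by simp
      moreover have "14 / 10 * ((4 + 5 * x) / 6) \<le> 14 / 10 * P" using nb(4) by simp
      ultimately show ?thesis using y unfolding x_def by (simp add: field_simps)
    next
      case False
      then have c: "c \<le> 211 / 1000" using I1_minus_le_const[of y] nb(7) by simp
      show ?thesis
      proof (cases "y \<le> 106 / 100")
        case True
        moreover have "14 / 10 * ((4 + 5 * x) / 6) \<le> 14 / 10 * P" using nb(4) by simp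
        ultimately show ?thesis using y c unfolding x_def by (simp add: field_simps)
      next
        case False
        moreover have "14 / 10 * x \<le> 14 / 10 * P" using nb(3) by simp
        ultimately show ?thesis using y c unfolding x_def by (simp add: field_simps)
      qed
    qed
    then have "t * P \<le> 14 / 10 * P" using t by simp
    then show ?thesis using nb(2) by simp
  qed
  then show "t \<le> 2" by simp
  have zt: "implied_rate s (- y) * (1 - t / 2) = P / 2 - P / 2 * (1 - t)\<^sup>2"
    unfolding z tz by (simp add: power2_eq_square field_simps)
  show "hazard (- y) * (1 - t)\<^sup>2 \<le> - y + implied_rate s (- y) * (1 - t / 2)" if "1 \<le> t"
  proof -
    have "(t - 1) * (t - 1) \<le> 4 / 10 * (4 / 10)" using that tup by (intro mult_mono) auto
    then have "(1 - t)\<^sup>2 \<le> 16 / 100" by (simp add: power2_eq_square algebra_simps)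
    then have "(l + P / 2) * (1 - t)\<^sup>2 \<le> (kap + P / 2) * (16 / 100)"
      using nb(2,9) l0 by (intro mult_mono) auto
    also have "\<dots> \<le> P / 2 - y" using nb(4) y kap_bounds unfolding x_def by (simp add: field_simps)
    finally show ?thesis unfolding zt l_def by (simp add: algebra_simps)
  qed
  show "(hazard (- y) + 1 / (2 * N (- y + s))) * (1 - t)\<^sup>2 \<le> - y + implied_rate s (- y) * (1 - t / 2)" if "t \<le> 1"
  proof -
    define g where "g = kap / P"
    have "e * P \<le> g * P" unfolding eP using nb(2,5) by (simp add: g_def)
    then have g: "0 < g" "e \<le> g" using nb(2) by (simp_all add: g_def pos_le_divide_eq)
    have "1 - t \<le> e * (1 - g)"
    proof -
      have "P * (1 - t) = P - x - (y + c)" using tz by (simp add: x_def algebra_simps)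
      also have "\<dots> \<le> P - x - kap * e" using nb(8) by simp
      also have "\<dots> = P * (e * (1 - g))" using nb(2) eP by (simp add: g_def algebra_simps)
      finally show ?thesis using nb(2) by simp
    qed
    then have "(1 - t)\<^sup>2 \<le> (e * (1 - g))\<^sup>2" using that by (intro power_mono) auto
    also have "\<dots> \<le> e * (1 / 4)"
    proof -
      have g1: "g \<le> 1" using nb(2) s y hazard_mono[of 0 "s + y"] by (simp add: g_def P_def hazard_0)
      have "0 \<le> (g - 1 / 2)\<^sup>2" by simp
      then have "g * (1 - g) \<le> 1 / 4" by (simp add: power2_eq_square algebra_simps)
      moreover have "(e * (1 - g))\<^sup>2 = e * ((1 - g) * (e * (1 - g)))" by (simp add: power2_eq_square)
      moreover have "(1 - g) * (e * (1 - g)) \<le> 1 * (g * (1 - g))"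
        using g g1 nb(11) by (intro mult_mono) (auto simp: e_def)
      ultimately have "(1 - g) * (e * (1 - g)) \<le> 1 / 4" by linarith
      then have "e * ((1 - g) * (e * (1 - g))) \<le> e * (1 / 4)" using nb(11) by (intro mult_left_mono) (auto simp: e_def)
      with \<open>(e * (1 - g))\<^sup>2 = _\<close> show ?thesis by simp
    qed
    finally have sq: "(1 - t)\<^sup>2 \<le> e / 4" by simp
    have "N 0 \<le> N (- y + s)" using y by (intro N_mono) simp
    then have "1 / (2 * N (- y + s)) \<le> kap / 2" by (simp add: N_0 field_simps)
    then have "(l + 1 / (2 * N (- y + s))) * (1 - t)\<^sup>2 \<le> (kap + kap / 2) * (e / 4)"
      using sq nb(9) l0 by (intro mult_mono) auto
    also have "\<dots> \<le> (y + c) / 2"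
    proof -
      have "0 \<le> kap * e" using nb(11) by simp
      then show ?thesis using nb(8) by simp
    qed
    also have "\<dots> \<le> - y + implied_rate s (- y) * (1 / 2)" using y unfolding z by simp
    also have "\<dots> \<le> - y + implied_rate s (- y) * (1 - t / 2)"
      using that y s nb(10) by (intro add_left_mono mult_left_mono) (auto simp: z)
    finally show ?thesis by (simp add: l_def)
  qed
qed

text \<open>The reciprocal of a Taylor bound for \<open>N\<close>; the decimals round \<open>1 / kap\<close> and \<open>1 / (2 * kap)\<close> down.\<close>

lemma hazard_minus_y:
  assumes "0 \<le> y"
  shows "hazard (- y) * (1253 / 1000 + y + 6265 / 10000 * y\<^sup>2) \<le> 1"
proof -
  have "1253 / 1000 \<le> 1 / kap" using kap_bounds by (simp add: field_simps)
  moreover have "6265 / 10000 * y\<^sup>2 \<le> y\<^sup>2 / (2 * kap)"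
    using kap_bounds mult_right_mono[of "6265 / 10000" "1 / (2 * kap)" "y\<^sup>2"] by (simp add: field_simps)
  ultimately have "1253 / 1000 + y + 6265 / 10000 * y\<^sup>2 \<le> N y"
    using N_ge_quadratic[OF assms] by linarith
  then have "hazard (- y) * (1253 / 1000 + y + 6265 / 10000 * y\<^sup>2) \<le> hazard (- y) * N y"
    by (intro mult_left_mono) auto
  then show ?thesis by (simp add: hazard_def)
qed

text \<open>A lower bound for the average slope of the hazard rate around \<open>y\<close>. If the interval contains no
  negative numbers, each half of it is estimated by the slope at its left end, using convexity. Otherwise
  the left end lies in the flat part, and the tangent at \<open>7 / 2\<close> controls the right end.\<close>

lemma hazard_spread:
  assumes y: "95 / 100 \<le> y" and s: "0 < s" "s < 2 * y"
  shows "11 / 8 * s \<le> hazard (y + s) - hazard (y - s)"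
proof (cases "s \<le> y")
  case True
  have h: "(4 + 5 * (95 / 100)) / 6 \<le> hazard (95 / 100)" by (rule hazard_ge_1) simp
  have "7413 / 10000 \<le> (4 + 5 * (95 / 100)) / 6 * ((4 + 5 * (95 / 100)) / 6 - 95 / (100::real))" by simp
  also have "\<dots> \<le> hazard (95 / 100) * (hazard (95 / 100) - 95 / 100)" using h by (intro mult_mono) auto
  also have "\<dots> \<le> hazard y * (hazard y - y)" by (rule hazard_slope_mono[OF y])
  finally have "7413 / 10000 * s \<le> hazard y * (hazard y - y) * s" using s by (intro mult_right_mono) auto
  moreover have "hazard y * (hazard y - y) * s \<le> hazard (y + s) - hazard y"
    using hazard_chord_bounds(1)[of y "y + s"] s by simp
  moreover have "6366 / 10000 \<le> kap * kap" using two_div_pi_bounds by (simp add: kap_sq)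
  then have "6366 / 10000 \<le> hazard (y - s) * (hazard (y - s) - (y - s))"
    using hazard_slope_mono[of 0 "y - s"] True by (simp add: hazard_0)
  then have "6366 / 10000 * s \<le> hazard (y - s) * (hazard (y - s) - (y - s)) * s" using s by (intro mult_right_mono) auto
  moreover have "hazard (y - s) * (hazard (y - s) - (y - s)) * s \<le> hazard y - hazard (y - s)"
    using hazard_chord_bounds(1)[of "y - s" y] s by simp
  ultimately show ?thesis using s by linarith
next
  case False
  define d where "d = s - y"
  have d: "0 \<le> d" "d \<le> y" using False s by (simp_all add: d_def)
  have P: "(8 + 17 * (y + s)) / 18 \<le> hazard (y + s)" using y s by (intro hazard_ge_2) simp
  have n: "125 / 100 + d \<le> N d"
  proof -
    have "125 / 100 \<le> 1 / kap" using kap_bounds by (simp add: pos_le_divide_eq)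
    then show ?thesis using N_ge_linear[OF d(1)] by linarith
  qed
  have "hazard (y - s) = 1 / N d" by (simp add: hazard_def d_def)
  also have "\<dots> \<le> 1 / (125 / 100 + d)" using n d by (intro divide_left_mono) auto
  finally have m: "hazard (y - s) \<le> 1 / (125 / 100 + d)" .
  have "1 / (125 / 100 + d) \<le> (8 + 17 * (2 * y + d)) / 18 - 11 / 8 * (y + d)"
  proof -
    have lin: "(8 + 17 * (2 * y + d)) / 18 - 11 / 8 * (y + d) = 8 / 18 + 37 / 72 * y - 31 / 72 * d"
      by (simp add: field_simps)
    have "1 \<le> ((8 + 17 * (2 * y + d)) / 18 - 11 / 8 * (y + d)) * (125 / 100 + d)"
    proof (cases "d \<le> 95 / 100")
      case True
      define A where "A = 8 / 18 + 37 / 72 * (95 / 100) - 31 / 72 * d"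
      have "A \<le> (8 + 17 * (2 * y + d)) / 18 - 11 / 8 * (y + d)" unfolding A_def lin using y by linarith
      then have "A * (125 / 100 + d) \<le> ((8 + 17 * (2 * y + d)) / 18 - 11 / 8 * (y + d)) * (125 / 100 + d)"
        using d by (intro mult_right_mono) auto
      moreover have "0 \<le> d * (95 / 100 - d)" using True d by simp
      then have "d * d \<le> 95 / 100 * d" by (simp add: algebra_simps)
      moreover have "A * (125 / 100 + d)
          = 1343 / 1152 + 568 / 1440 * d - 31 / 72 * (d * d)"
        by (simp add: A_def field_simps)
      then have "1 \<le> A * (125 / 100 + d)" using True d \<open>d * d \<le> 95 / 100 * d\<close> by linarith
      ultimately show ?thesis by linarith
    next
      case False
      have "1 \<le> (52 / 100) * (2::real)" by simp
      also have "\<dots> \<le> ((8 + 17 * (2 * y + d)) / 18 - 11 / 8 * (y + d)) * (125 / 100 + d)"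
      proof (rule mult_mono)
        show "52 / 100 \<le> (8 + 17 * (2 * y + d)) / 18 - 11 / 8 * (y + d)"
          unfolding lin using False d by linarith
        then show "0 \<le> (8 + 17 * (2 * y + d)) / 18 - 11 / 8 * (y + d)" by linarith
      qed (use False in auto)
      finally show ?thesis .
    qed
    then show ?thesis using d by (simp add: pos_divide_le_eq)
  qed
  moreover have "2 * y + d = y + s" "y + d = s" by (simp_all add: d_def)
  ultimately have "1 / (125 / 100 + d) \<le> (8 + 17 * (y + s)) / 18 - 11 / 8 * s" by (simp only:)
  with P m show ?thesis by linarith
qed

text \<open>Here \<open>z > 2 s\<close>. In terms of \<open>c = z - s - 2 * y\<close> the claim is
  \<open>hazard (- y) * (1 - t)\<^sup>2 \<le> y * (3 - 2 * t) + (2 - t) * c\<close>, and for \<open>t \<ge> 1\<close> it is enough to check it at an upper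
  bound of \<open>t\<close>, because the left-hand side increases and the right-hand side decreases there. For small \<open>y\<close> Jensen's inequality gives \<open>t \<le> 29 / 20\<close>. For
  large \<open>y\<close> the condition \<open>v\<close> that the profit does not fall bounds \<open>t\<close> by the inverse of the average
  slope of the hazard rate.\<close>

lemma premise_negative_threshold:
  fixes s y defines "t \<equiv> N (- y - s) * implied_rate s (- y)"
  assumes s: "0 < s" and y: "0 \<le> y" "s < 2 * y"
    and v: "implied_rate s (- y) * (N (- y + s) - N (- y - s)) \<le> 2 * s * N (- y + s)"
  shows "hazard (- y) * (1 - t)\<^sup>2 \<le> - y + (2 - t) * (implied_rate s (- y) - s)"
proof -
  define x where "x = s + y"
  define P where "P = hazard (s + y)"
  define c where "c = implied_rate s (- y) - s - 2 * y"
  define e where "e = 1 - x / P"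
  define l where "l = hazard (- y)"
  note nb = bounds_negative_threshold[OF s y(1), folded P_def, folded x_def, folded c_def, folded e_def, folded l_def]
  have l0: "0 \<le> l" by (simp add: l_def)
  have z: "implied_rate s (- y) = s + 2 * y + c" by (simp add: c_def)
  have t: "t * P = s + 2 * y + c" using nb(1,2) by (simp add: t_def z)
  have tz: "s + 2 * y + c = P * t" using t by (simp add: mult.commute)
  have e1: "e \<le> 1" using nb(2) s y by (simp add: e_def x_def)
  have rhs: "- y + (2 - t) * (implied_rate s (- y) - s) = y * (3 - 2 * t) + (2 - t) * c"
    by (simp add: z algebra_simps)
  have step: ?thesis if "1 \<le> t" "t \<le> T" "l * (T - 1)\<^sup>2 \<le> y * (3 - 2 * T) + (2 - T) * c" for T
  proof -
    have "(1 - t)\<^sup>2 = (t - 1)\<^sup>2" by (simp add: power2_commute)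
    also have "\<dots> \<le> (T - 1)\<^sup>2" using that by (intro power_mono) auto
    finally have "l * (1 - t)\<^sup>2 \<le> l * (T - 1)\<^sup>2" using l0 by (intro mult_left_mono)
    also note that(3)
    also have "y * (3 - 2 * T) + (2 - T) * c \<le> y * (3 - 2 * t) + (2 - t) * c"
      using that y nb(10) by (intro add_mono mult_left_mono mult_right_mono) auto
    finally show ?thesis unfolding rhs l_def .
  qed
  show ?thesis
  proof (cases "1 \<le> t")
    case False
    have "P * (1 - t) \<le> P - x" using tz y nb(10) by (simp add: x_def algebra_simps)
    then have "1 - t \<le> e" using nb(2) by (simp add: e_def field_simps)
    then have "(1 - t)\<^sup>2 \<le> e\<^sup>2" using False by (intro power_mono) auto
    also have "\<dots> \<le> e" using e1 nb(11) by (simp add: power2_eq_square e_def mult_left_le)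
    finally have "l * (1 - t)\<^sup>2 \<le> kap * e" using nb(9) l0 by (intro mult_mono) auto
    also have "\<dots> \<le> y + c" by (rule nb(8))
    also have "\<dots> \<le> y * (3 - 2 * t) + (2 - t) * c"
      using False y nb(10) mult_left_mono[of 1 "3 - 2 * t" y] mult_right_mono[of 1 "2 - t" c] by simp
    finally show ?thesis unfolding rhs l_def .
  next
    case t1: True
    show ?thesis
    proof (cases "y \<le> 95 / 100")
      case True
      have c: "c \<le> 8 / 10 - 62 / 100 * y" using I1_minus_le[OF y(1) True] nb(7) by simp
      have "145 / 100 * ((4 + 5 * x) / 6) \<le> 145 / 100 * P" using nb(4) by simp
      then have "s + 2 * y + c \<le> 145 / 100 * P"
        using c True s unfolding x_def by (simp add: field_simps)
      then have "t * P \<le> 145 / 100 * P" using t by simp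
      then have t2: "t \<le> 145 / 100" using nb(2) by simp
      have e: "(4 - 3 * y) / (4 + 15 * y) \<le> e"
      proof -
        have "x / P \<le> x / ((4 + 5 * x) / 6)"
          using nb(2,4) s y by (intro divide_left_mono) (auto simp: x_def)
        also have "\<dots> = 6 * x / (4 + 5 * x)" by simp
        also have "6 * x / (4 + 5 * x) \<le> 18 * y / (4 + 15 * y)"
        proof -
          have "x \<le> 3 * y" using y by (simp add: x_def)
          then have "6 * x * (4 + 15 * y) \<le> 18 * y * (4 + 5 * x)" by (simp add: algebra_simps)
          moreover have "0 < 4 + 5 * x" "0 < 4 + 15 * y" using s y by (simp_all add: x_def)
          ultimately show ?thesis by (simp add: frac_le_eq divide_nonpos_pos)
        qed
        finally have "x / P \<le> 18 * y / (4 + 15 * y)" .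
        moreover have "(4 - 3 * y) / (4 + 15 * y) = 1 - 18 * y / (4 + 15 * y)" using y by (simp add: field_simps)
        ultimately show ?thesis unfolding e_def by linarith
      qed
      have "l * (1 / 2) \<le> phi y"
      proof -
        have "1 / 2 \<le> Phi y" using Phi_strict_mono[of 0 y] y Phi_0 by (cases "y = 0") auto
        then have "l * (1 / 2) \<le> l * Phi y" using l0 by (intro mult_left_mono)
        also have "\<dots> = phi y" by (simp add: Phi_eq_N l_def hazard_def)
        finally show ?thesis .
      qed
      then have "l * e \<le> 2 * phi y * e" using nb(11) by (intro mult_right_mono) (auto simp: e_def)
      then have "l * e \<le> c" using nb(6) by linarith
      moreover have "l * ((4 - 3 * y) / (4 + 15 * y)) \<le> l * e" using e l0 by (rule mult_left_mono)
      ultimately have lc: "l * ((4 - 3 * y) / (4 + 15 * y)) \<le> c" by linarith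
      have "l * (45 / 100)\<^sup>2 \<le> l * (1 / 10 * (y * (1253 / 1000 + y + 6265 / 10000 * y\<^sup>2))
          + 55 / 100 * ((4 - 3 * y) / (4 + 15 * y)))"
      proof (intro mult_left_mono l0)
        \<comment> \<open>Tangents to the cube and the fourth power at 1/2 leave a quadratic with minimum near 0.527.\<close>
        define q2 q3 q4 where "q2 = y * y" "q3 = y * q2" "q4 = y * q3"
        note q = q2_q3_q4_def
        have "0 \<le> (y - 1 / 2)\<^sup>2 * (y + 1)" "0 \<le> (y\<^sup>2 - 1 / 4)\<^sup>2 + (y - 1 / 2)\<^sup>2 / 2"
          "0 \<le> (y - 527 / 1000)\<^sup>2"
          using y by auto
        then have F: "0 \<le> q3 - 3 / 4 * y + 1 / 4" "0 \<le> q4 - 1 / 2 * y + 3 / 16"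
          "0 \<le> q2 - 1054 / 1000 * y + 277729 / 1000000"
          by (simp_all add: q power2_eq_square field_simps)
        have "1 / 10 * (y * (1253 / 1000 + y + 6265 / 10000 * y\<^sup>2)) * (4 + 15 * y) + 55 / 100 * (4 - 3 * y)
          = 22 / 10 - 11488 / 10000 * y + 22795 / 10000 * q2 + 17506 / 10000 * q3 + 93975 / 100000 * q4"
          by (simp add: q power2_eq_square field_simps)
        moreover have "(45 / 100)\<^sup>2 * (4 + 15 * y) = 81 / 100 + 30375 / 10000 * y"
          by (simp add: power2_eq_square field_simps)
        ultimately have "(45 / 100)\<^sup>2 * (4 + 15 * y)
          \<le> 1 / 10 * (y * (1253 / 1000 + y + 6265 / 10000 * y\<^sup>2)) * (4 + 15 * y) + 55 / 100 * (4 - 3 * y)"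
          using F True by linarith
        then show "(45 / 100)\<^sup>2 \<le> 1 / 10 * (y * (1253 / 1000 + y + 6265 / 10000 * y\<^sup>2))
          + 55 / 100 * ((4 - 3 * y) / (4 + 15 * y))"
          using y by (simp add: field_simps)
      qed
      also have "l * (a * (y * b) + d * f) = y * a * (l * b) + d * (l * f)" for a b d f :: real
        by (simp add: algebra_simps)
      also have "y * (1 / 10) * (l * (1253 / 1000 + y + 6265 / 10000 * y\<^sup>2))
          + 55 / 100 * (l * ((4 - 3 * y) / (4 + 15 * y))) \<le> y * (1 / 10) * 1 + 55 / 100 * c"
        using hazard_minus_y[OF y(1)] lc y by (intro add_mono mult_left_mono) (auto simp: l_def)
      finally show ?thesis using t1 t2 by (intro step[of "145 / 100"]) auto
    next
      case False
      have D: "11 / 8 * s \<le> P - hazard (y - s)"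
        using hazard_spread[of y s] False s y by (simp add: P_def add.commute)
      define m where "m = hazard (y - s)"
      have m: "0 < m" "N (- y + s) = 1 / m" by (simp_all add: m_def hazard_def)
      have "P * t * (1 / m - 1 / P) \<le> 2 * s * (1 / m)"
        using v unfolding nb(1) m(2) z tz .
      moreover have "P * t * (1 / m - 1 / P) = t * (P - m) * (1 / m)" using nb(2) m(1) by (simp add: field_simps)
      ultimately have "t * (P - m) * (1 / m) \<le> 2 * s * (1 / m)" by simp
      then have "t * (P - m) \<le> 2 * s" by (rule mult_right_le_imp_le) (use m in simp)
      moreover have "t * (11 / 8 * s) \<le> t * (P - m)" using t1 D by (intro mult_left_mono) (auto simp: m_def)
      ultimately have "s * (t * 11) \<le> s * 16" by (simp add: algebra_simps)
      then have t2: "t \<le> 16 / 11" using s by simp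
      have "1253 / 1000 + 95 / 100 + 56 / 100 \<le> 1253 / 1000 + y + 6265 / 10000 * y\<^sup>2"
        using False power_mono[of "95 / 100" y 2] by (simp add: power2_eq_square)
      then have "l * (27 / 10) \<le> l * (1253 / 1000 + y + 6265 / 10000 * y\<^sup>2)"
        using l0 by (intro mult_left_mono) auto
      also have "\<dots> \<le> 1" using hazard_minus_y[OF y(1)] by (simp only: l_def)
      finally have "l * (27 / 10) \<le> 1" .
      then have "l * (16 / 11 - 1)\<^sup>2 \<le> y * (3 - 2 * (16 / 11)) + (2 - 16 / 11) * c"
        using False nb(10) by (simp add: power2_eq_square)
      with t1 t2 show ?thesis by (rule step)
    qed
  qed
qed

text \<open>The three regimes with \<open>- 2 w \<le> s\<close> go through \<open>curvature_le\<close>. In the remaining one \<open>r > 1\<close>, and for small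
  \<open>s\<close> the sharper criterion \<open>curvature_nonpos\<close> is needed.\<close>

lemma curvature_dichotomy:
  assumes s: "0 < s" and z: "0 < implied_rate s w"
    and v: "implied_rate s w * (N (w + s) - N (w - s)) \<le> 2 * s * N (w + s)"
  shows "curvature s w (implied_rate s w) \<le> 0 \<or>
    N (w + s) * curvature s w (implied_rate s w) \<le> (2 * s * N (w + s) - implied_rate s w * (N (w + s) - N (w - s)))\<^sup>2"
proof -
  consider "0 \<le> w" "s \<le> w" | "0 \<le> w" "w < s" | "w < 0" "- 2 * w \<le> s" | "w < 0" "s < - 2 * w"
    by linarith
  then show ?thesis
  proof cases
    case 1
    show ?thesis by (rule curvature_le[OF s z v premises_small_scale[OF s 1(2) z]])
  next
    case 2
    show ?thesis by (rule curvature_le[OF s z v premises_low_threshold[OF 2 z]])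
  next
    case 3
    then have y: "0 \<le> - w" "2 * - w \<le> s" by simp_all
    show ?thesis by (rule curvature_le[OF s z v premises_large_scale[OF s y, unfolded minus_minus]])
  next
    case 4
    then have y: "0 \<le> - w" "s < 2 * - w" by simp_all
    have "2 * s \<le> implied_rate s w"
      using bounds_negative_threshold(10)[OF s y(1)] y(2) unfolding minus_minus by linarith
    then have "curvature s w (implied_rate s w) \<le> 0"
      using premise_negative_threshold[OF s y, unfolded minus_minus, OF v] by (rule curvature_nonpos[OF z _ v])
    then show ?thesis ..
  qed
qed

section \<open>The censor point\<close>

text \<open>The mean of \<open>min X c\<close>.\<close>

definition capped_mean :: "real \<Rightarrow> real \<Rightarrow> real" where
  "capped_mean s w = Phi (w - s) + exp (s * w - s\<^sup>2 / 2) * Phi (- w)"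

lemma capped_mean_eq: "capped_mean s w = exp (s * w - s\<^sup>2 / 2) * scaled_mean s w"
  by (simp add: capped_mean_def scaled_mean_def Phi_eq_N phi_exp_shift algebra_simps)

lemma DERIV_capped_mean:
  "(capped_mean s has_real_derivative s * exp (s * w - s\<^sup>2 / 2) * Phi (- w)) (at w)"
proof -
  have 1: "((\<lambda>w. Phi (w - s)) has_real_derivative phi (w - s) * (1 - 0)) (at w)"
    by (rule DERIV_chain2[OF DERIV_Phi]) (intro DERIV_diff DERIV_ident DERIV_const)
  have 2: "((\<lambda>w. exp (s * w - s\<^sup>2 / 2)) has_real_derivative exp (s * w - s\<^sup>2 / 2) * (s * 1 - 0)) (at w)"
    by (rule DERIV_chain2[OF DERIV_exp]) (intro DERIV_diff DERIV_cmult DERIV_ident DERIV_const)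
  have 3: "((\<lambda>w. Phi (- w)) has_real_derivative phi (- w) * (- 1)) (at w)"
    by (rule DERIV_chain2[OF DERIV_Phi]) (intro DERIV_minus DERIV_ident)
  show ?thesis
    unfolding capped_mean_def[abs_def]
    by (rule DERIV_cong[OF DERIV_add[OF 1 DERIV_mult[OF 2 3]]]) (simp add: phi_exp_shift)
qed

lemma DERIV_capped_mean_scale:
  "((\<lambda>s. capped_mean s w) has_real_derivative
      - phi (w - s) + (w - s) * exp (s * w - s\<^sup>2 / 2) * Phi (- w)) (at s)"
proof -
  have 1: "((\<lambda>s. Phi (w - s)) has_real_derivative phi (w - s) * (0 - 1)) (at s)"
    by (rule DERIV_chain2[OF DERIV_Phi]) (intro DERIV_diff DERIV_ident DERIV_const)
  have "((\<lambda>s. s * w - s\<^sup>2 / 2) has_real_derivative w - s) (at s)"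
    by (auto intro!: derivative_eq_intros)
  then have 2: "((\<lambda>s. exp (s * w - s\<^sup>2 / 2)) has_real_derivative exp (s * w - s\<^sup>2 / 2) * (w - s)) (at s)"
    by (rule DERIV_chain2[OF DERIV_exp])
  show ?thesis
    unfolding capped_mean_def
    by (rule DERIV_cong[OF DERIV_add[OF 1 DERIV_mult[OF 2 DERIV_const]]]) simp
qed

lemma capped_mean_strict_mono: "0 < s \<Longrightarrow> w < w' \<Longrightarrow> capped_mean s w < capped_mean s w'"
proof (rule DERIV_pos_imp_increasing[of w w' "capped_mean s"])
  fix u assume s: "0 < s"
  then have "0 < s * exp (s * u - s\<^sup>2 / 2) * Phi (- u)" by simp
  with DERIV_capped_mean[of s u]
  show "\<exists>d. (capped_mean s has_real_derivative d) (at u) \<and> d > 0" by blast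
qed

lemma capped_mean_less_iff: "0 < s \<Longrightarrow> capped_mean s w < capped_mean s w' \<longleftrightarrow> w < w'"
  using capped_mean_strict_mono by (metis less_asym linorder_cases)

lemma ex1_capped_mean:
  assumes s: "0 < s" and e: "0 < e" "e < 1"
  shows "\<exists>!w. e = capped_mean s w"
proof -
  have "((\<lambda>w. Phi (w - s) + exp (- (s\<^sup>2) / 2) * exp (s * w)) \<longlongrightarrow> 0 + exp (- (s\<^sup>2) / 2) * 0) at_bot"
  proof (intro tendsto_add tendsto_mult tendsto_const)
    show "((\<lambda>w. Phi (w - s)) \<longlongrightarrow> 0) at_bot"
    proof (rule filterlim_compose[OF tendsto_Phi_at_bot])
      show "filterlim (\<lambda>w. w - s) at_bot at_bot"
        unfolding filterlim_at_bot
      proof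
        fix Z
        show "\<forall>\<^sub>F w in at_bot. w - s \<le> Z"
          using eventually_le_at_bot[of "Z + s"] by eventually_elim simp
      qed
    qed
    have "filterlim (\<lambda>w. s * w) at_bot at_bot"
      using s by (intro filterlim_tendsto_pos_mult_at_bot[OF tendsto_const _ filterlim_ident])
    then show "((\<lambda>w. exp (s * w)) \<longlongrightarrow> 0) at_bot"
      by (rule filterlim_compose[OF exp_at_bot])
  qed
  from order_tendstoD(2)[OF this, of e]
  have "\<forall>\<^sub>F w in at_bot. Phi (w - s) + exp (- (s\<^sup>2) / 2) * exp (s * w) < e"
    using e by simp
  then obtain a where "Phi (a - s) + exp (- (s\<^sup>2) / 2) * exp (s * a) < e"
    using eventually_happens'[OF trivial_limit_at_bot_linorder] by blast
  moreover have "capped_mean s a \<le> Phi (a - s) + exp (- (s\<^sup>2) / 2) * exp (s * a)"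
  proof -
    have "exp (s * a - s\<^sup>2 / 2) * Phi (- a) \<le> exp (s * a - s\<^sup>2 / 2) * 1"
      by (intro mult_left_mono) (auto intro: less_imp_le)
    also have "\<dots> = exp (- (s\<^sup>2) / 2) * exp (s * a)" by (simp flip: exp_add)
    finally show ?thesis by (simp add: capped_mean_def)
  qed
  ultimately have a: "capped_mean s a < e" by simp
  have "((\<lambda>w. Phi (w - s)) \<longlongrightarrow> 1) at_top"
  proof (rule filterlim_compose[OF tendsto_Phi_at_top])
    show "filterlim (\<lambda>w. w - s) at_top at_top"
      unfolding filterlim_at_top
    proof
      fix Z
      show "\<forall>\<^sub>F w in at_top. Z \<le> w - s"
        using eventually_ge_at_top[of "Z + s"] by eventually_elim simp
    qed
  qed
  from order_tendstoD(1)[OF this e(2)] obtain b where "e < Phi (b - s)"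
    using eventually_happens'[OF trivial_limit_at_top_linorder] by blast
  moreover have "Phi (b - s) < capped_mean s b" by (simp add: capped_mean_def)
  ultimately have b: "e < capped_mean s b" by simp
  have ab: "a < b" using a b capped_mean_less_iff[OF s, of a b] by simp
  have "\<exists>w\<ge>a. w \<le> b \<and> capped_mean s w = e"
    using a b ab by (intro IVT) (auto intro: DERIV_isCont[OF DERIV_capped_mean])
  moreover have "w = w'" if "e = capped_mean s w" "e = capped_mean s w'" for w w'
    using that capped_mean_less_iff[OF s] by (metis less_irrefl linorder_neqE)
  ultimately show ?thesis by metis
qed

lemma normal_censor_eq:
  assumes "0 < \<mu>" "0 < s"
  shows "capped_mean s (normal_censor \<mu> s) = exp (- \<mu>)"
  using theI'[OF ex1_capped_mean[OF assms(2), of "exp (- \<mu>)"]] assms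
  by (simp add: normal_censor_def capped_mean_def)

text \<open>The implicit function theorem in one variable for a given continuous solution \<open>w_at\<close>: the mean value
  theorem in the second variable turns \<open>F s (w_at s) = 0\<close> into a formula for the difference quotient.\<close>

lemma implicit_derivative:
  fixes F Fw :: "real \<Rightarrow> real \<Rightarrow> real" and w_at :: "real \<Rightarrow> real"
  assumes zero: "\<forall>\<^sub>F s in at s0. F s (w_at s) = 0" and zero0: "F s0 (w_at s0) = 0"
    and dw: "\<And>s w. (F s has_real_derivative Fw s w) (at w)"
    and ds: "((\<lambda>s. F s (w_at s0)) has_real_derivative a) (at s0)"
    and cont: "isCont w_at s0" and contw: "isCont (\<lambda>(s, w). Fw s w) (s0, w_at s0)"
    and nz: "Fw s0 (w_at s0) \<noteq> 0"
  shows "(w_at has_real_derivative - a / Fw s0 (w_at s0)) (at s0)"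
proof -
  define w0 where "w0 = w_at s0"
  have "\<exists>x. \<bar>x - w0\<bar> \<le> \<bar>w_at s - w0\<bar> \<and> F s (w_at s) - F s w0 = (w_at s - w0) * Fw s x" for s
  proof -
    consider "w_at s = w0" | "w0 < w_at s" | "w_at s < w0" by linarith
    then show ?thesis
    proof cases
      case 2
      from MVT2[OF 2 dw] obtain x where "w0 < x" "x < w_at s" "F s (w_at s) - F s w0 = (w_at s - w0) * Fw s x"
        by blast
      then show ?thesis by (intro exI[of _ x]) auto
    next
      case 3
      from MVT2[OF 3 dw] obtain x where "w_at s < x" "x < w0" "F s w0 - F s (w_at s) = (w0 - w_at s) * Fw s x"
        by blast
      then show ?thesis by (intro exI[of _ x]) (auto simp: algebra_simps)
    qed (auto intro: exI[of _ w0])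
  qed
  then obtain x where x: "\<And>s. \<bar>x s - w0\<bar> \<le> \<bar>w_at s - w0\<bar>"
    and mv: "\<And>s. F s (w_at s) - F s w0 = (w_at s - w0) * Fw s (x s)" by metis
  have w_at: "((\<lambda>s. \<bar>w_at s - w0\<bar>) \<longlongrightarrow> 0) (at s0)"
    using cont unfolding isCont_def w0_def by (intro tendsto_rabs_zero) (simp add: LIM_zero)
  have "((\<lambda>s. x s - w0) \<longlongrightarrow> 0) (at s0)"
    by (rule Lim_null_comparison[OF _ w_at]) (simp add: x)
  then have "(x \<longlongrightarrow> w0) (at s0)" by (simp add: LIM_zero_iff)
  then have "((\<lambda>s. (s, x s)) \<longlongrightarrow> (s0, w0)) (at s0)" by (intro tendsto_Pair tendsto_ident_at)
  from isCont_tendsto_compose[OF contw[folded w0_def] this]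
  have Fx: "((\<lambda>s. Fw s (x s)) \<longlongrightarrow> Fw s0 w0) (at s0)" by simp
  have "((\<lambda>s. - ((F s w0 - F s0 w0) / (s - s0)) / Fw s (x s)) \<longlongrightarrow> - a / Fw s0 w0) (at s0)"
    using ds nz unfolding w0_def[symmetric] has_field_derivative_iff
    by (intro tendsto_divide tendsto_minus Fx)
  moreover have "\<forall>\<^sub>F s in at s0. - ((F s w0 - F s0 w0) / (s - s0)) / Fw s (x s) = (w_at s - w_at s0) / (s - s0)"
    using zero tendsto_imp_eventually_ne[OF Fx nz[folded w0_def]] eventually_neq_at_within[of s0]
  proof eventually_elim
    case (elim s)
    have "- (F s w0 - F s0 w0) = (w_at s - w_at s0) * Fw s (x s)"
      using mv[of s] elim zero0 by (simp add: w0_def)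
    then have "- ((F s w0 - F s0 w0) / (s - s0)) = (w_at s - w_at s0) / (s - s0) * Fw s (x s)"
      by (metis minus_divide_left times_divide_eq_left)
    then show ?case using elim by simp
  qed
  ultimately show ?thesis
    unfolding has_field_derivative_iff w0_def[symmetric] by (rule Lim_transform_eventually)
qed

section \<open>The profit at a fixed rate per unit of variance\<close>

text \<open>For fixed \<open>\<mu>\<close> and \<open>\<sigma>\<close> the parameters \<open>(\<mu> \<theta>, \<sigma> sqrt \<theta>)\<close> have the form \<open>(r s\<^sup>2, s)\<close> with \<open>r = \<mu> / \<sigma>\<^sup>2\<close>. So all
  derivatives are taken along such a curve, with respect to \<open>s\<close>.\<close>

definition censor_path :: "real \<Rightarrow> real \<Rightarrow> real" where
  "censor_path r s = normal_censor (r * s\<^sup>2) s"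

text \<open>The derivative of the profit with respect to \<open>s\<^sup>2\<close>.\<close>

definition gain_rate :: "real \<Rightarrow> real \<Rightarrow> real" where
  "gain_rate r s = (let w = censor_path r s in
     (1 - r) * (exp (s\<^sup>2 - r * s\<^sup>2) * Phi (w + s)) + r * (exp (s\<^sup>2 - r * s\<^sup>2 - 2 * (s * w)) * Phi (w - s)))"

definition path_profit :: "real \<Rightarrow> real \<Rightarrow> real" where
  "path_profit r s = profit (r * s\<^sup>2) s"

lemma path_profit_eq:
  "path_profit r s = exp (s\<^sup>2 - r * s\<^sup>2) * Phi (censor_path r s + s)
     + exp (- (r * s\<^sup>2) - s * censor_path r s + s\<^sup>2 / 2) * Phi (- censor_path r s)"
  by (simp add: path_profit_def profit_def censor_path_def Let_def)

context
  fixes r :: real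
  assumes r: "0 < r"
begin

abbreviation "w_at \<equiv> censor_path r"

lemma path_eq: "0 < s \<Longrightarrow> capped_mean s (w_at s) = exp (- (r * s\<^sup>2))"
  using normal_censor_eq[of "r * s\<^sup>2" s] r by (simp add: censor_path_def)

lemma path_scaled_mean: "0 < s \<Longrightarrow> scaled_mean s (w_at s) = exp (- (r * s\<^sup>2) - s * w_at s + s\<^sup>2 / 2)"
proof -
  assume "0 < s"
  then have "exp (s * w_at s - s\<^sup>2 / 2) * scaled_mean s (w_at s) = exp (s * w_at s - s\<^sup>2 / 2) * exp (- (r * s\<^sup>2) - s * w_at s + s\<^sup>2 / 2)"
    using path_eq[of s] by (simp add: capped_mean_eq flip: exp_add)
  then show ?thesis by simp
qed

lemma path_implied_rate: "0 < s \<Longrightarrow> implied_rate s (w_at s) = 2 * r * s"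
  by (simp add: implied_rate_def path_scaled_mean field_simps power2_eq_square)

lemma isCont_path:
  assumes s0: "0 < s0"
  shows "isCont w_at s0"
  unfolding isCont_def
proof (rule order_tendstoI)
  have ev: "\<forall>\<^sub>F s in at s0. 0 < s" using order_tendstoD(1)[OF tendsto_ident_at s0] .
  have e: "((\<lambda>s. exp (- (r * s\<^sup>2))) \<longlongrightarrow> exp (- (r * s0\<^sup>2))) (at s0)"
    by (intro tendsto_intros)
  have c: "((\<lambda>s. capped_mean s w - exp (- (r * s\<^sup>2))) \<longlongrightarrow> capped_mean s0 w - exp (- (r * s0\<^sup>2))) (at s0)" for w
    using DERIV_isCont[OF DERIV_capped_mean_scale] unfolding isCont_def by (rule tendsto_diff[OF _ e])
  fix a
  show "\<forall>\<^sub>F s in at s0. a < w_at s" if "a < w_at s0"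
  proof -
    have "capped_mean s0 a - exp (- (r * s0\<^sup>2)) < 0"
      using that capped_mean_less_iff[OF s0, of a "w_at s0"] path_eq[OF s0] by simp
    from order_tendstoD(2)[OF c this] ev show ?thesis
    proof eventually_elim
      case (elim s)
      then show ?case using capped_mean_less_iff[of s a "w_at s"] path_eq[of s] by simp
    qed
  qed
  show "\<forall>\<^sub>F s in at s0. w_at s < a" if "w_at s0 < a"
  proof -
    have "0 < capped_mean s0 a - exp (- (r * s0\<^sup>2))"
      using that capped_mean_less_iff[OF s0, of "w_at s0" a] path_eq[OF s0] by simp
    from order_tendstoD(1)[OF c this] ev show ?thesis
    proof eventually_elim
      case (elim s)
      then show ?case using capped_mean_less_iff[of s "w_at s" a] path_eq[of s] by simp
    qed
  qed
qed

definition path_slope :: "real \<Rightarrow> real" where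
  "path_slope s = (hazard (w_at s) - w_at s + s - 2 * r * s * (1 + N (w_at s - s) * hazard (w_at s))) / s"

lemma DERIV_path:
  assumes s: "0 < s"
  shows "(w_at has_real_derivative path_slope s) (at s)"
proof -
  define w where "w = w_at s"
  define F where "F = (\<lambda>s w. capped_mean s w - exp (- (r * s\<^sup>2)))"
  define Fw where "Fw = (\<lambda>s w. s * exp (s * w - s\<^sup>2 / 2) * Phi (- w))"
  define Fs where "Fs = - phi (w - s) + (w - s) * exp (s * w - s\<^sup>2 / 2) * Phi (- w)
      - exp (- (r * s\<^sup>2)) * - (r * (2 * s))"
  have "(w_at has_real_derivative - Fs / Fw s (w_at s)) (at s)"
  proof (rule implicit_derivative[of F])
    have "\<forall>\<^sub>F u in at s. 0 < u" using order_tendstoD(1)[OF tendsto_ident_at s] .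
    then show "\<forall>\<^sub>F u in at s. F u (w_at u) = 0"
      by eventually_elim (simp add: F_def path_eq)
    show "F s (w_at s) = 0" using s by (simp add: F_def path_eq)
    show "(F u has_real_derivative Fw u v) (at v)" for u v
      unfolding F_def Fw_def by (rule DERIV_cong[OF DERIV_diff[OF DERIV_capped_mean DERIV_const]]) simp
    have "((\<lambda>s. exp (- (r * s\<^sup>2))) has_real_derivative exp (- (r * s\<^sup>2)) * - (r * (2 * s))) (at s)"
      by (rule DERIV_chain2[OF DERIV_exp]) (auto intro!: derivative_eq_intros)
    then show "((\<lambda>u. F u (w_at s)) has_real_derivative Fs) (at s)"
      unfolding F_def Fs_def w_def[symmetric] by (intro DERIV_diff DERIV_capped_mean_scale)
    show "isCont w_at s" by (rule isCont_path[OF s])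
    have "isCont (\<lambda>p. Phi (- snd p)) (s, w_at s)"
      by (rule isCont_o2[where g=Phi, OF _ DERIV_isCont[OF DERIV_Phi]]) (intro continuous_intros)
    then have "isCont (\<lambda>p. fst p * exp (fst p * snd p - (fst p)\<^sup>2 / 2) * Phi (- snd p)) (s, w_at s)"
      by (intro continuous_intros) auto
    then show "isCont (\<lambda>(s, w). Fw s w) (s, w_at s)"
      by (simp add: Fw_def case_prod_unfold)
    show "Fw s (w_at s) \<noteq> 0" using s by (simp add: Fw_def less_imp_neq[OF Phi_pos, symmetric])
  qed
  also have "- Fs / Fw s (w_at s) = path_slope s"
  proof -
    define c where "c = exp (s * w - s\<^sup>2 / 2)"
    have c: "c > 0" by (simp add: c_def)
    have m: "exp (- (r * s\<^sup>2)) = c * (phi w * (N (w - s) + N (- w)))"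
      using path_eq[OF s] unfolding capped_mean_eq by (simp add: w_def c_def scaled_mean_def)
    have hN: "hazard w = 1 / N (- w)" by (simp add: hazard_def)
    have "- Fs = c * (phi w - (w - s) * (phi w * N (- w)) - 2 * r * s * (phi w * (N (w - s) + N (- w))))"
      unfolding Fs_def m phi_exp_shift c_def[symmetric] Phi_eq_N[of "- w"] by (simp add: algebra_simps)
    also have "\<dots> = (c * (phi w * N (- w))) * (hazard w - (w - s) - 2 * r * s * (1 + N (w - s) * hazard w))"
      unfolding hN by (simp add: field_simps)
    finally have "- Fs = (c * (phi w * N (- w))) * (hazard w - (w - s) - 2 * r * s * (1 + N (w - s) * hazard w))" .
    moreover have "Fw s (w_at s) = s * (c * (phi w * N (- w)))"
      by (simp add: Fw_def w_def c_def Phi_eq_N)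
    moreover have "c * (phi w * N (- w)) \<noteq> 0" using c by simp
    ultimately have "- Fs / Fw s (w_at s) = (hazard w - (w - s) - 2 * r * s * (1 + N (w - s) * hazard w)) / s"
      by simp
    then show ?thesis by (simp add: path_slope_def w_def algebra_simps)
  qed
  finally show ?thesis .
qed

text \<open>Along the curve all exponential prefactors combine with the shifted densities to the same product.\<close>

lemma path_factors:
  assumes s: "0 < s"
  shows "exp (s\<^sup>2 - r * s\<^sup>2) * phi (w_at s + s) = scaled_mean s (w_at s) * phi (w_at s)"
    "exp (s\<^sup>2 - r * s\<^sup>2 - 2 * (s * w_at s)) * phi (w_at s - s) = scaled_mean s (w_at s) * phi (w_at s)"
proof -
  show "exp (s\<^sup>2 - r * s\<^sup>2) * phi (w_at s + s) = scaled_mean s (w_at s) * phi (w_at s)"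
    using phi_exp_shift[of "w_at s" "- s"] unfolding path_scaled_mean[OF s]
    by (simp add: mult.assoc[symmetric] flip: exp_add)
  show "exp (s\<^sup>2 - r * s\<^sup>2 - 2 * (s * w_at s)) * phi (w_at s - s) = scaled_mean s (w_at s) * phi (w_at s)"
    unfolding path_scaled_mean[OF s] phi_exp_shift
    by (simp add: mult.assoc[symmetric] flip: exp_add)
qed

lemma gain_rate_factor:
  assumes s: "0 < s"
  shows "gain_rate r s = scaled_mean s (w_at s) * phi (w_at s) * ((1 - r) * N (w_at s + s) + r * N (w_at s - s))"
proof -
  have "gain_rate r s = (1 - r) * (exp (s\<^sup>2 - r * s\<^sup>2) * phi (w_at s + s)) * N (w_at s + s)
     + r * (exp (s\<^sup>2 - r * s\<^sup>2 - 2 * (s * w_at s)) * phi (w_at s - s)) * N (w_at s - s)"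
    by (simp add: gain_rate_def Let_def Phi_eq_N mult_ac)
  then show ?thesis
    unfolding path_factors[OF s] by (simp add: algebra_simps)
qed

lemma gain_rate_eq:
  assumes s: "0 < s"
  shows "gain_rate r s = scaled_mean s (w_at s) * phi (w_at s) *
     ((2 * s * N (w_at s + s) - implied_rate s (w_at s) * (N (w_at s + s) - N (w_at s - s))) / (2 * s))"
proof -
  have "(1 - r) * N (w_at s + s) + r * N (w_at s - s)
      = (2 * s * N (w_at s + s) - implied_rate s (w_at s) * (N (w_at s + s) - N (w_at s - s))) / (2 * s)"
    using s by (simp add: path_implied_rate field_simps)
  then show ?thesis by (simp only: gain_rate_factor[OF s])
qed

lemma path_profit_factor:
  assumes s: "0 < s"
  shows "path_profit r s = scaled_mean s (w_at s) * phi (w_at s) * (N (w_at s + s) + N (- w_at s))"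
proof -
  have "path_profit r s = (exp (s\<^sup>2 - r * s\<^sup>2) * phi (w_at s + s)) * N (w_at s + s) + scaled_mean s (w_at s) * (phi (w_at s) * N (- w_at s))"
    by (simp add: path_profit_eq path_scaled_mean[OF s] Phi_eq_N mult_ac)
  then show ?thesis unfolding path_factors(1)[OF s] by (simp add: algebra_simps)
qed

text \<open>The derivative of the censor point cancels, because \<open>Phi (- w) * hazard w\<close> is the density \<open>phi w\<close>.\<close>

lemma DERIV_path_profit:
  assumes s: "0 < s"
  shows "(path_profit r has_real_derivative 2 * s * gain_rate r s) (at s)"
proof -
  define w where "w = w_at s"
  define w' where "w' = path_slope s"
  define q where "q = scaled_mean s w"
  define b where "b = N (- w)"
  define al where "al = N (w - s)"
  define ep where "ep = N (w + s)"
  have q: "q = exp (- (r * s\<^sup>2) - s * w + s\<^sup>2 / 2)" using path_scaled_mean[OF s] by (simp add: q_def w_def)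
  have d: "(w_at has_real_derivative w') (at s)" unfolding w'_def by (rule DERIV_path[OF s])
  have 1: "((\<lambda>s. exp (s\<^sup>2 - r * s\<^sup>2)) has_real_derivative exp (s\<^sup>2 - r * s\<^sup>2) * (2 * s - r * (2 * s))) (at s)"
    by (rule DERIV_chain2[OF DERIV_exp]) (auto intro!: derivative_eq_intros)
  have 2: "((\<lambda>s. Phi (w_at s + s)) has_real_derivative phi (w_at s + s) * (w' + 1)) (at s)"
    by (rule DERIV_chain2[OF DERIV_Phi]) (intro DERIV_add d DERIV_ident)
  have 3: "((\<lambda>s. exp (- (r * s\<^sup>2) - s * w_at s + s\<^sup>2 / 2)) has_real_derivative
      exp (- (r * s\<^sup>2) - s * w_at s + s\<^sup>2 / 2) * (- (r * (2 * s)) - (w_at s + s * w') + s)) (at s)"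
    by (rule DERIV_chain2[OF DERIV_exp]) (auto intro!: derivative_eq_intros d)
  have 4: "((\<lambda>s. Phi (- w_at s)) has_real_derivative phi (- w_at s) * - w') (at s)"
    by (rule DERIV_chain2[OF DERIV_Phi]) (intro DERIV_minus d)
  have "(path_profit r has_real_derivative
      exp (s\<^sup>2 - r * s\<^sup>2) * (2 * s - r * (2 * s)) * Phi (w + s) + phi (w + s) * (w' + 1) * exp (s\<^sup>2 - r * s\<^sup>2)
      + (q * (- (r * (2 * s)) - (w + s * w') + s) * Phi (- w) + phi (- w) * - w' * q)) (at s)"
    using DERIV_add[OF DERIV_mult[OF 1 2] DERIV_mult[OF 3 4]]
    unfolding path_profit_eq[abs_def] q w_def[symmetric] .
  moreover have "exp (s\<^sup>2 - r * s\<^sup>2) * (2 * s - r * (2 * s)) * Phi (w + s) + phi (w + s) * (w' + 1) * exp (s\<^sup>2 - r * s\<^sup>2)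
      + (q * (- (r * (2 * s)) - (w + s * w') + s) * Phi (- w) + phi (- w) * - w' * q) = 2 * s * gain_rate r s"
  proof -
    have E: "exp (s\<^sup>2 - r * s\<^sup>2) * phi (w + s) = q * phi w"
      using path_factors(1)[OF s] by (simp add: w_def q_def)
    have b: "b * hazard w = 1" by (simp add: b_def hazard_def)
    have sw: "s * w' = hazard w - w + s - 2 * r * s * (1 + al * hazard w)"
      using s by (simp add: w'_def path_slope_def w_def al_def)
    have k: "b * (- (2 * r * s) - w - s * w' + s) = 2 * r * s * al - 1"
    proof -
      have "b * (- (2 * r * s) - w - s * w' + s) = 2 * r * s * al * (b * hazard w) - b * hazard w"
        unfolding sw by (simp add: algebra_simps)
      then show ?thesis by (simp add: b)
    qed
    have "exp (s\<^sup>2 - r * s\<^sup>2) * (2 * s - r * (2 * s)) * Phi (w + s) + phi (w + s) * (w' + 1) * exp (s\<^sup>2 - r * s\<^sup>2)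
      + (q * (- (r * (2 * s)) - (w + s * w') + s) * Phi (- w) + phi (- w) * - w' * q)
      = (exp (s\<^sup>2 - r * s\<^sup>2) * phi (w + s)) * ((2 * s - 2 * r * s) * ep + w' + 1)
        + q * phi w * (b * (- (2 * r * s) - w - s * w' + s) - w')"
      by (simp add: Phi_eq_N ep_def b_def algebra_simps)
    also have "\<dots> = q * phi w * ((2 * s - 2 * r * s) * ep + 2 * r * s * al)"
      unfolding E k by (simp add: algebra_simps)
    also have "\<dots> = 2 * s * gain_rate r s"
      unfolding gain_rate_factor[OF s] by (simp add: q_def w_def ep_def al_def algebra_simps)
    finally show ?thesis .
  qed
  ultimately show ?thesis by simp
qed

lemma DERIV_gain_rate:
  assumes s: "0 < s"
  shows "(gain_rate r has_real_derivative scaled_mean s (w_at s) * phi (w_at s) * curvature s (w_at s) (implied_rate s (w_at s)) / s) (at s)"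
proof -
  define w where "w = w_at s"
  define w' where "w' = path_slope s"
  define q where "q = scaled_mean s w"
  define z where "z = implied_rate s w"
  define al where "al = N (w - s)"
  define ep where "ep = N (w + s)"
  define l where "l = hazard w"
  define E1 where "E1 = exp (s\<^sup>2 - r * s\<^sup>2)"
  define E2 where "E2 = exp (s\<^sup>2 - r * s\<^sup>2 - 2 * (s * w))"
  have z: "z = 2 * r * s" using path_implied_rate[OF s] by (simp add: z_def w_def)
  have d: "(w_at has_real_derivative w') (at s)" unfolding w'_def by (rule DERIV_path[OF s])
  have 1: "((\<lambda>s. exp (s\<^sup>2 - r * s\<^sup>2)) has_real_derivative E1 * (2 * s - r * (2 * s))) (at s)"
    unfolding E1_def by (rule DERIV_chain2[OF DERIV_exp]) (auto intro!: derivative_eq_intros)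
  have 2: "((\<lambda>s. Phi (w_at s + s)) has_real_derivative phi (w_at s + s) * (w' + 1)) (at s)"
    by (rule DERIV_chain2[OF DERIV_Phi]) (intro DERIV_add d DERIV_ident)
  have 3: "((\<lambda>s. exp (s\<^sup>2 - r * s\<^sup>2 - 2 * (s * w_at s))) has_real_derivative
      E2 * (2 * s - r * (2 * s) - 2 * (w + s * w'))) (at s)"
    unfolding E2_def w_def by (rule DERIV_chain2[OF DERIV_exp]) (auto intro!: derivative_eq_intros d)
  have 4: "((\<lambda>s. Phi (w_at s - s)) has_real_derivative phi (w_at s - s) * (w' - 1)) (at s)"
    by (rule DERIV_chain2[OF DERIV_Phi]) (intro DERIV_diff d DERIV_ident)
  have "(gain_rate r has_real_derivative
      (1 - r) * (E1 * (2 * s - r * (2 * s)) * Phi (w + s) + phi (w + s) * (w' + 1) * E1)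
      + r * (E2 * (2 * s - r * (2 * s) - 2 * (w + s * w')) * Phi (w - s) + phi (w - s) * (w' - 1) * E2)) (at s)"
    using DERIV_add[OF DERIV_cmult[OF DERIV_mult[OF 1 2], of "1 - r"] DERIV_cmult[OF DERIV_mult[OF 3 4], of r]]
    unfolding gain_rate_def[abs_def] Let_def E1_def[symmetric] w_def[symmetric] E2_def[symmetric] .
  moreover have "(1 - r) * (E1 * (2 * s - r * (2 * s)) * Phi (w + s) + phi (w + s) * (w' + 1) * E1)
      + r * (E2 * (2 * s - r * (2 * s) - 2 * (w + s * w')) * Phi (w - s) + phi (w - s) * (w' - 1) * E2)
    = q * phi w * curvature s w z / s"
  proof -
    have E: "E1 * phi (w + s) = q * phi w" "E2 * phi (w - s) = q * phi w"
      using path_factors[OF s] by (simp_all add: w_def q_def E1_def E2_def)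
    have sw: "s * w' = l - w + s - z * (1 + al * l)"
      using s by (simp add: w'_def path_slope_def w_def al_def l_def z)
    have "(1 - r) * (E1 * (2 * s - r * (2 * s)) * Phi (w + s) + phi (w + s) * (w' + 1) * E1)
      + r * (E2 * (2 * s - r * (2 * s) - 2 * (w + s * w')) * Phi (w - s) + phi (w - s) * (w' - 1) * E2)
      = (E1 * phi (w + s)) * ((1 - r) * ((2 * s - z) * ep + w' + 1))
        + (E2 * phi (w - s)) * (r * ((2 * s - z - 2 * w - 2 * (s * w')) * al + w' - 1))"
      by (simp add: Phi_eq_N ep_def al_def z algebra_simps)
    also have "\<dots> = q * phi w * ((1 - r) * ((2 * s - z) * ep) + w' + 1 - 2 * r
        + r * ((2 * s - z - 2 * w - 2 * (s * w')) * al))"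
      unfolding E by (simp add: algebra_simps)
    also have "\<dots> = q * phi w * (s * ((1 - r) * ((2 * s - z) * ep) + w' + 1 - 2 * r
        + r * ((2 * s - z - 2 * w - 2 * (s * w')) * al)) / s)"
      using s by simp
    also have "s * ((1 - r) * ((2 * s - z) * ep) + w' + 1 - 2 * r + r * ((2 * s - z - 2 * w - 2 * (s * w')) * al))
        = (2 * s - z) * ((2 * s - z) * ep) / 2 + s * w' + s - z + z * ((2 * s - z - 2 * w - 2 * (s * w')) * al) / 2"
      by (simp add: z field_simps)
    also have "\<dots> = curvature s w z"
      unfolding sw curvature_def ep_def[symmetric] al_def[symmetric] l_def[symmetric]
      by (simp add: field_simps power2_eq_square)
    finally show ?thesis by simp
  qed
  ultimately show ?thesis by (simp add: w_def q_def z_def)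
qed

end

section \<open>Curvature of the profit\<close>

text \<open>Strict log-convexity of \<open>N\<close>.\<close>

lemma N_product_gt: "0 < s \<Longrightarrow> (N w)\<^sup>2 < N (w + s) * N (w - s)"
proof -
  assume s: "0 < s"
  define f where "f = (\<lambda>s. ln (N (w + s)) + ln (N (w - s)))"
  have ratio: "N1 u / N u < N1 v / N v" if "u < v" for u v
  proof (rule DERIV_pos_imp_increasing[OF that])
    fix x
    have "((\<lambda>x. N1 x / N x) has_real_derivative (N2 x * N x - N1 x * N1 x) / (N x * N x)) (at x)"
      by (intro DERIV_divide DERIV_N DERIV_N1) simp
    moreover have "0 < (N2 x * N x - N1 x * N1 x) / (N x * N x)"
      using N1_sq_less[of x] by (simp add: power2_eq_square mult.commute)
    ultimately show "\<exists>d. ((\<lambda>x. N1 x / N x) has_real_derivative d) (at x) \<and> d > 0" by blast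
  qed
  have d: "(f has_real_derivative N1 (w + x) / N (w + x) - N1 (w - x) / N (w - x)) (at x)" for x
  proof -
    have 1: "((\<lambda>x. N (w + x)) has_real_derivative N1 (w + x) * (0 + 1)) (at x)"
      by (rule DERIV_chain2[OF DERIV_N]) (intro DERIV_add DERIV_const DERIV_ident)
    have 2: "((\<lambda>x. N (w - x)) has_real_derivative N1 (w - x) * (0 - 1)) (at x)"
      by (rule DERIV_chain2[OF DERIV_N]) (intro DERIV_diff DERIV_const DERIV_ident)
    show ?thesis
      unfolding f_def
      by (rule DERIV_cong[OF DERIV_add[OF DERIV_chain2[OF DERIV_ln_divide 1] DERIV_chain2[OF DERIV_ln_divide 2]]]) auto
  qed
  have "f 0 < f s"
  proof (rule DERIV_pos_imp_increasing_open[OF s])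
    fix x :: real assume "0 < x" "x < s"
    then have "0 < N1 (w + x) / N (w + x) - N1 (w - x) / N (w - x)"
      using ratio[of "w - x" "w + x"] by simp
    with d[of x] show "\<exists>y. (f has_real_derivative y) (at x) \<and> 0 < y" by blast
  qed (intro DERIV_continuous_on[OF DERIV_subset[OF d]] subset_UNIV)
  then have "ln ((N w)\<^sup>2) < ln (N (w + s) * N (w - s))"
    by (simp add: f_def ln_mult ln_realpow)
  then show ?thesis by simp
qed

lemma scaled_mean_le_1: "0 \<le> s \<Longrightarrow> scaled_mean s w \<le> 1"
proof -
  assume "0 \<le> s"
  then have "phi w * (N (w - s) + N (- w)) \<le> phi w * (N w + N (- w))"
    using N_mono[of "w - s" w] by (intro mult_left_mono add_mono) auto
  then show ?thesis by (simp add: scaled_mean_def phi_N_sum)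
qed

context
  fixes r :: real
  assumes r: "0 < r"
begin

text \<open>The inequality \<open>E Y * E (1 / Y) > 1\<close>, written as
  \<open>(N (w - s) + N (- w)) * (N (w + s) + N (- w)) > (N w + N (- w))\<^sup>2\<close>. It follows from log-convexity and
  convexity of \<open>N\<close>.\<close>

lemma path_profit_gt_1:
  assumes s: "0 < s"
  shows "1 < path_profit r s"
proof -
  define w where "w = censor_path r s"
  define al ep p b where "al = N (w - s)" "ep = N (w + s)" "p = N w" "b = N (- w)"
  note d = al_ep_p_b_def
  have pos: "0 < b" "0 < phi w" by (simp_all add: d)
  have "p * p < al * ep" using N_product_gt[OF s, of w] by (simp add: d power2_eq_square mult.commute)
  moreover have "2 * p \<le> al + ep"
    using N_chord(1)[of w "w + s"] N_chord(2)[of "w - s" w] s by (simp add: d)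
  then have "b * (2 * p) \<le> b * (al + ep)" using pos by (intro mult_left_mono) auto
  ultimately have "(p + b) * (p + b) < (al + b) * (ep + b)" by (simp add: algebra_simps)
  then have "(phi w * phi w) * ((p + b) * (p + b)) < (phi w * phi w) * ((al + b) * (ep + b))"
    using pos by (intro mult_strict_left_mono) auto
  moreover have "(phi w * phi w) * ((p + b) * (p + b)) = (phi w * (p + b)) * (phi w * (p + b))" by simp
  moreover have "phi w * (p + b) = 1" using phi_N_sum[of w] by (simp add: d)
  moreover have "path_profit r s = (phi w * phi w) * ((al + b) * (ep + b))"
    using path_profit_factor[OF r s] by (simp add: d w_def scaled_mean_def mult_ac)
  ultimately show ?thesis by simp
qed

text \<open>Only good for small \<open>s\<close>, where it yields the limit 1.\<close>

lemma path_profit_le: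
  assumes s: "0 < s"
  shows "path_profit r s \<le> exp (s\<^sup>2) + s"
proof -
  define w where "w = censor_path r s"
  have "scaled_mean s w \<le> 1" using s by (simp add: scaled_mean_le_1)
  then have "scaled_mean s w * Phi (- w) \<le> 1 * Phi (- w)" by (intro mult_right_mono) (auto intro: less_imp_le)
  moreover have "exp (s\<^sup>2 - r * s\<^sup>2) * Phi (w + s) \<le> exp (s\<^sup>2) * Phi (w + s)"
    using r by (intro mult_right_mono) (auto intro: less_imp_le)
  moreover have "path_profit r s = exp (s\<^sup>2 - r * s\<^sup>2) * Phi (w + s) + scaled_mean s w * Phi (- w)"
    unfolding w_def path_scaled_mean[OF r s] by (rule path_profit_eq)
  ultimately have "path_profit r s \<le> exp (s\<^sup>2) * Phi (w + s) + Phi (- w)"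
    by linarith
  then have "path_profit r s \<le> exp (s\<^sup>2) * Phi (w + s) + (1 - Phi w)"
    by (simp only: Phi_minus)
  also have "\<dots> = (exp (s\<^sup>2) - 1) * Phi (w + s) + (Phi (w + s) - Phi w) + 1" by (simp add: algebra_simps)
  also have "(exp (s\<^sup>2) - 1) * Phi (w + s) \<le> (exp (s\<^sup>2) - 1) * 1"
    by (intro mult_left_mono) (auto intro: less_imp_le)
  also have "Phi (w + s) - Phi w \<le> s"
  proof -
    obtain u where "Phi (w + s) - Phi w = (w + s - w) * phi u"
      using MVT2[of w "w + s" Phi phi] DERIV_Phi s by (metis less_add_same_cancel1)
    moreover have "phi u \<le> 1"
    proof -
      have "phi u \<le> kap / 2 * 1" unfolding phi_gauss by (intro mult_left_mono) auto
      then show ?thesis using kap_bounds by simp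
    qed
    then have "s * phi u \<le> s * 1" using s by (intro mult_left_mono) auto
    ultimately show ?thesis by simp
  qed
  finally show ?thesis by simp
qed

lemma tendsto_path_profit_0: "(path_profit r \<longlongrightarrow> 1) (at_right 0)"
proof (rule tendsto_sandwich)
  have ev: "\<forall>\<^sub>F s in at_right 0. (0::real) < s" by (rule eventually_at_right_less)
  show "\<forall>\<^sub>F s in at_right 0. 1 \<le> path_profit r s"
    using ev by eventually_elim (intro less_imp_le path_profit_gt_1)
  show "\<forall>\<^sub>F s in at_right 0. path_profit r s \<le> exp (s\<^sup>2) + s"
    using ev by eventually_elim (rule path_profit_le)
  have "((\<lambda>s::real. exp (s\<^sup>2) + s) \<longlongrightarrow> exp (0\<^sup>2) + 0) (at_right 0)"
    by (intro tendsto_intros)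
  then show "((\<lambda>s::real. exp (s\<^sup>2) + s) \<longlongrightarrow> 1) (at_right 0)" by simp
qed simp

text \<open>This is \<open>u u'' < 2 u'\<^sup>2\<close>, where the primes stand for derivatives with respect to \<open>s\<^sup>2\<close>: then \<open>D\<close> is
  \<open>2 s u''\<close>. The inequality is strict because the bound of \<open>u\<close> by a multiple of
  \<open>N (w + s)\<close> is.\<close>

lemma gain_curvature:
  assumes s: "0 < s" and v: "0 < gain_rate r s" 
    and d: "(gain_rate r has_real_derivative D) (at s)"
  shows "(path_profit r s - 1) * D < 4 * s * (gain_rate r s)\<^sup>2"
proof -
  define w where "w = censor_path r s"
  define k where "k = scaled_mean s w * phi w"
  define e where "e = N (w + s)"
  define y where "y = 2 * s * e - implied_rate s w * (e - N (w - s))"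
  define c where "c = curvature s w (implied_rate s w)"
  define u where "u = path_profit r s - 1"
  have k: "0 < k" by (simp add: k_def)
  have e: "0 < e" by (simp add: e_def)
  have g: "gain_rate r s = k * (y / (2 * s))"
    using gain_rate_eq[OF r s] by (simp add: k_def y_def e_def w_def)
  have y: "0 < y" using v s k unfolding g by (simp add: zero_less_mult_iff zero_less_divide_iff)
  have D: "D = k * c / s"
    using DERIV_unique[OF d DERIV_gain_rate[OF r s]] by (simp add: k_def c_def w_def)
  have u: "0 < u" using path_profit_gt_1[OF s] by (simp add: u_def)
  have "k * N (- w) < 1"
  proof -
    have "k * N (- w) = scaled_mean s w * Phi (- w)" by (simp add: k_def Phi_eq_N)
    also have "\<dots> \<le> 1 * Phi (- w)" using s by (intro mult_right_mono scaled_mean_le_1) (auto intro: less_imp_le)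
    also have "\<dots> < 1" by simp
    finally show ?thesis .
  qed
  then have ue: "u < k * e"
    using path_profit_factor[OF r s] by (simp add: u_def k_def e_def w_def distrib_left)
  have "implied_rate s w = 2 * r * s" using path_implied_rate[OF r s] by (simp add: w_def)
  then have z: "0 < implied_rate s w" using r s by simp
  have "c \<le> 0 \<or> e * c \<le> y\<^sup>2"
    using curvature_dichotomy[OF s z] y unfolding c_def y_def e_def by simp
  then have "u * c < k * y\<^sup>2"
  proof
    assume "c \<le> 0"
    then have "u * c \<le> 0" using u by (simp add: mult_nonneg_nonpos)
    also have "0 < k * y\<^sup>2" using k y by simp
    finally show ?thesis .
  next
    assume le: "e * c \<le> y\<^sup>2"
    show ?thesis
    proof (cases "c \<le> 0")
      case True
      then have "u * c \<le> 0" using u by (simp add: mult_nonneg_nonpos)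
      also have "0 < k * y\<^sup>2" using k y by simp
      finally show ?thesis .
    next
      case False
      then have "u * c < k * e * c" using ue by (intro mult_strict_right_mono) auto
      also have "\<dots> \<le> k * y\<^sup>2" using le k by (simp add: mult.assoc)
      finally show ?thesis .
    qed
  qed
  then have "k / s * (u * c) < k / s * (k * y\<^sup>2)"
    using k s by (intro mult_strict_left_mono) auto
  moreover have "k / s * (k * y\<^sup>2) = 4 * s * (k * (y / (2 * s)))\<^sup>2"
    using s by (simp add: power2_eq_square)
  ultimately show ?thesis unfolding g D u_def[symmetric] by (simp add: mult_ac)
qed

end

text \<open>A function that falls through each of its zeros is negative just to the right of the first one. The
  leftmost point after that where it is nonnegative would be a zero through which it rises.\<close>

lemma at_most_one_falling_zero:
  fixes f f' :: "real \<Rightarrow> real"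
  assumes d: "\<And>x. a \<le> x \<Longrightarrow> x \<le> b \<Longrightarrow> (f has_real_derivative f' x) (at x)"
    and neg: "\<And>x. a \<le> x \<Longrightarrow> x \<le> b \<Longrightarrow> f x = 0 \<Longrightarrow> f' x < 0"
    and ab: "a < b" and z: "f a = 0" "f b = 0"
  shows False
proof -
  have da: "(f has_real_derivative f' a) (at a)" "f' a < 0" using d[of a] neg[of a] ab z by simp_all
  from DERIV_neg_dec_right[OF da]
  obtain e where e: "0 < e" "\<And>h. 0 < h \<Longrightarrow> h < e \<Longrightarrow> f (a + h) < f a"
    by blast
  define x1 where "x1 = a + min (e / 2) ((b - a) / 2)"
  have "x1 \<le> a + e / 2" "x1 \<le> a + (b - a) / 2"
    unfolding x1_def by (intro add_left_mono min.cobounded1 min.cobounded2)+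
  moreover have "a < x1" "e / 2 < e" "(b - a) / 2 < b - a" using e(1) ab by (simp_all add: x1_def)
  ultimately have x1: "a < x1" "x1 < b" "x1 - a < e"
    by linarith+
  then have fx1: "f x1 < 0" using e(2)[of "x1 - a"] z by simp
  define S where "S = {x \<in> {x1..b}. 0 \<le> f x}"
  have cont: "continuous_on {x1..b} f"
  proof (intro continuous_at_imp_continuous_on ballI)
    fix x assume "x \<in> {x1..b}"
    then show "isCont f x" using DERIV_isCont[OF d[of x]] x1(1) by simp
  qed
  have "S = {x1..b} \<inter> f -` {0..}" by (auto simp: S_def)
  then have "closed S" using continuous_closed_preimage[OF cont, of "{0..}"] by simp
  then have "compact ({x1..b} \<inter> S)" by (intro compact_Int_closed compact_Icc)
  moreover have "{x1..b} \<inter> S = S" by (auto simp: S_def)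
  ultimately have "compact S" by simp
  moreover have "b \<in> S" using x1 z by (simp add: S_def)
  ultimately obtain c where c: "c \<in> S" "\<And>x. x \<in> S \<Longrightarrow> c \<le> x"
    using compact_attains_inf[of S] by fast
  have c1: "x1 < c" "c \<le> b" using c(1) fx1 by (auto simp: S_def order_less_le)
  have fc: "f c = 0"
  proof (rule ccontr)
    assume "f c \<noteq> 0"
    then have "0 < f c" using c(1) by (simp add: S_def)
    moreover have "isCont f x" if "x1 \<le> x" "x \<le> c" for x
      using d[of x] that x1 c1 by (intro DERIV_isCont) auto
    ultimately obtain x where x: "x1 \<le> x" "x \<le> c" "f x = 0"
      using IVT[of f x1 0 c] fx1 c1 by auto
    then have "x \<in> S" using c1 by (simp add: S_def)
    from c(2)[OF this] x \<open>0 < f c\<close> show False by (cases "x = c") auto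
  qed
  have dc: "(f has_real_derivative f' c) (at c)" "f' c < 0" using d[of c] neg[of c] c1 x1 fc by simp_all
  from DERIV_neg_dec_left[OF dc]
  obtain e' where e': "0 < e'" "\<And>h. 0 < h \<Longrightarrow> h < e' \<Longrightarrow> f c < f (c - h)"
    by blast
  define h where "h = min (e' / 2) ((c - x1) / 2)"
  have "h \<le> e' / 2" "h \<le> (c - x1) / 2"
    unfolding h_def by (rule min.cobounded1 min.cobounded2)+
  moreover have "0 < h" "e' / 2 < e'" "(c - x1) / 2 < c - x1" using e'(1) c1 by (simp_all add: h_def)
  ultimately have h: "0 < h" "h < e'" "x1 < c - h" by linarith+
  have "c - h \<in> S" using e'(2)[OF h(1,2)] fc h c1 by (simp add: S_def)
  from c(2)[OF this] h show False by simp
qed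

section \<open>Critical points of the objective\<close>

lemma gbar_eq_path_profit:
  assumes "0 < \<sigma>" "0 < \<theta>"
  shows "gbar \<mu> \<sigma> \<theta> = path_profit (\<mu> / \<sigma>\<^sup>2) (\<sigma> * sqrt \<theta>)"
  using assms by (simp add: gbar_def path_profit_def power_mult_distrib)

context
  fixes \<mu> \<sigma> :: real
  assumes \<mu>: "0 < \<mu>" and \<sigma>: "0 < \<sigma>"
begin

abbreviation "rate \<equiv> \<mu> / \<sigma>\<^sup>2"

lemma rate_pos: "0 < rate" using \<mu> \<sigma> by simp

definition gbar_slope :: "real \<Rightarrow> real" where
  "gbar_slope \<theta> = \<sigma>\<^sup>2 * gain_rate rate (\<sigma> * sqrt \<theta>)"

lemma DERIV_scale:
  assumes "0 < \<theta>"
  shows "((\<lambda>\<theta>. \<sigma> * sqrt \<theta>) has_real_derivative \<sigma>\<^sup>2 / (2 * (\<sigma> * sqrt \<theta>))) (at \<theta>)"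
  using DERIV_cmult[OF DERIV_real_sqrt[OF assms], of \<sigma>] \<sigma> assms
  by (simp add: field_simps power2_eq_square)

lemma DERIV_gbar:
  assumes t: "0 < \<theta>"
  shows "(gbar \<mu> \<sigma> has_real_derivative gbar_slope \<theta>) (at \<theta>)"
proof -
  have s: "0 < \<sigma> * sqrt \<theta>" using \<sigma> t by simp
  have "((\<lambda>\<theta>. path_profit rate (\<sigma> * sqrt \<theta>)) has_real_derivative
      2 * (\<sigma> * sqrt \<theta>) * gain_rate rate (\<sigma> * sqrt \<theta>) * (\<sigma>\<^sup>2 / (2 * (\<sigma> * sqrt \<theta>)))) (at \<theta>)"
    by (rule DERIV_chain2[OF DERIV_path_profit[OF rate_pos s] DERIV_scale[OF t]])
  moreover have "2 * (\<sigma> * sqrt \<theta>) * gain_rate rate (\<sigma> * sqrt \<theta>) * (\<sigma>\<^sup>2 / (2 * (\<sigma> * sqrt \<theta>))) = gbar_slope \<theta>"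
    using t \<sigma> by (simp add: gbar_slope_def)
  ultimately have "((\<lambda>\<theta>. path_profit rate (\<sigma> * sqrt \<theta>)) has_real_derivative gbar_slope \<theta>) (at \<theta>)"
    by simp
  then show ?thesis
    by (rule has_field_derivative_transform_within_open[of _ _ _ "{0<..}"])
       (use t \<sigma> gbar_eq_path_profit in auto)
qed

lemma gbar_gt_1: "0 < \<theta> \<Longrightarrow> 1 < gbar \<mu> \<sigma> \<theta>"
  using path_profit_gt_1[OF rate_pos, of "\<sigma> * sqrt \<theta>"] \<sigma> by (simp add: gbar_eq_path_profit)

lemma gbar_0: "gbar \<mu> \<sigma> 0 = 1"
  by (simp add: gbar_def)

definition R_slope :: "real \<Rightarrow> real" where
  "R_slope \<theta> = 1 - gbar \<mu> \<sigma> \<theta> + (1 - \<theta>) * gbar_slope \<theta>"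

lemma DERIV_R:
  assumes "0 < \<theta>"
  shows "(R \<mu> \<sigma> has_real_derivative R_slope \<theta>) (at \<theta>)"
proof -
  have "((\<lambda>\<theta>. \<theta> + (1 - \<theta>) * gbar \<mu> \<sigma> \<theta>) has_real_derivative
      1 + ((0 - 1) * gbar \<mu> \<sigma> \<theta> + gbar_slope \<theta> * (1 - \<theta>))) (at \<theta>)"
    by (intro DERIV_add DERIV_mult DERIV_diff DERIV_const DERIV_ident DERIV_gbar assms)
  then show ?thesis by (simp add: R_def[abs_def] R_slope_def algebra_simps)
qed

text \<open>Where \<open>R_slope\<close> vanishes the derivative of \<open>gbar\<close> cannot, since \<open>gbar\<close> exceeds 1.\<close>

lemma first_order_condition_iff:
  assumes t: "0 < \<theta>" "\<theta> < 1"
  shows "first_order_condition \<mu> \<sigma> \<theta> \<longleftrightarrow> R_slope \<theta> = 0"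
proof -
  have d: "gbar \<mu> \<sigma> differentiable (at \<theta>)" "deriv (gbar \<mu> \<sigma>) \<theta> = gbar_slope \<theta>"
    using DERIV_gbar[OF t(1)] by (auto simp: DERIV_imp_deriv real_differentiable_def)
  have u: "gbar \<mu> \<sigma> \<theta> - 1 > 0" using gbar_gt_1[OF t(1)] by simp
  show ?thesis
  proof (cases "gbar_slope \<theta> = 0")
    case True
    then show ?thesis using u by (simp add: first_order_condition_def R_slope_def d)
  next
    case False
    then have "first_order_condition \<mu> \<sigma> \<theta> \<longleftrightarrow> gbar \<mu> \<sigma> \<theta> - 1 = (1 - \<theta>) * gbar_slope \<theta>"
      unfolding first_order_condition_def gbar_0 d(2) using d(1) by (simp add: divide_eq_eq)
    then show ?thesis unfolding R_slope_def by linarith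
  qed
qed

text \<open>At a zero, \<open>(1 - \<theta>) \<sigma>\<^sup>2 v = u\<close> for the profit gain \<open>u\<close> and the gain rate \<open>v\<close>. So \<open>v\<close> is positive, and
  after elimination of \<open>1 - \<theta>\<close> the claim \<open>R'' < 0\<close> is \<open>gain_curvature\<close>.\<close>

lemma R_slope_falls_at_zero:
  assumes t: "0 < \<theta>" "\<theta> < 1"
  shows "\<exists>D. (R_slope has_real_derivative D) (at \<theta>) \<and> (R_slope \<theta> = 0 \<longrightarrow> D < 0)"
proof -
  define s where "s = \<sigma> * sqrt \<theta>"
  define v where "v = gain_rate rate s"
  have s: "0 < s" using \<sigma> t by (simp add: s_def)
  obtain E where E: "(gain_rate rate has_real_derivative E) (at s)"
    using DERIV_gain_rate[OF rate_pos s] by blast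
  have "(gbar_slope has_real_derivative \<sigma>\<^sup>2 * (E * (\<sigma>\<^sup>2 / (2 * s)))) (at \<theta>)"
    unfolding gbar_slope_def s_def
    by (intro DERIV_cmult DERIV_chain2[OF _ DERIV_scale[OF t(1)]]) (use E in \<open>simp add: s_def\<close>)
  then have "((\<lambda>\<theta>. 1 - gbar \<mu> \<sigma> \<theta> + (1 - \<theta>) * gbar_slope \<theta>) has_real_derivative
     0 - gbar_slope \<theta> + ((0 - 1) * gbar_slope \<theta> + \<sigma>\<^sup>2 * (E * (\<sigma>\<^sup>2 / (2 * s))) * (1 - \<theta>))) (at \<theta>)"
    by (intro DERIV_add DERIV_mult DERIV_diff DERIV_const DERIV_ident DERIV_gbar t)
  then have 1: "(R_slope has_real_derivative 0 - gbar_slope \<theta> + ((0 - 1) * gbar_slope \<theta> + \<sigma>\<^sup>2 * (E * (\<sigma>\<^sup>2 / (2 * s))) * (1 - \<theta>))) (at \<theta>)"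
    by (simp only: R_slope_def[abs_def])
  have 2: "0 - gbar_slope \<theta> + ((0 - 1) * gbar_slope \<theta> + \<sigma>\<^sup>2 * (E * (\<sigma>\<^sup>2 / (2 * s))) * (1 - \<theta>)) < 0" if z: "R_slope \<theta> = 0"
  proof -
    define u where "u = path_profit rate s - 1"
    have gv: "gbar_slope \<theta> = \<sigma>\<^sup>2 * v" by (simp add: gbar_slope_def v_def s_def)
    have u: "u = (1 - \<theta>) * (\<sigma>\<^sup>2 * v)"
      using z gbar_eq_path_profit[OF \<sigma> t(1)] by (simp add: R_slope_def gv u_def s_def)
    have "0 < u" using path_profit_gt_1[OF rate_pos s] by (simp add: u_def)
    then have v: "0 < v" unfolding u using t \<sigma> by (simp add: zero_less_mult_iff)
    have "u * E < 4 * s * v\<^sup>2"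
      using gain_curvature[OF rate_pos s _ E] v by (simp add: u_def v_def)
    then have "(1 - \<theta>) * (\<sigma>\<^sup>2 * v) * E < 4 * s * v * v" unfolding u by (simp add: power2_eq_square mult.assoc)
    then have "v * ((1 - \<theta>) * \<sigma>\<^sup>2 * E) < v * (4 * s * v)" by (simp add: mult_ac)
    then have "(1 - \<theta>) * \<sigma>\<^sup>2 * E < 4 * s * v" using v by simp
    then have "\<sigma>\<^sup>2 / (2 * s) * ((1 - \<theta>) * \<sigma>\<^sup>2 * E) < \<sigma>\<^sup>2 / (2 * s) * (4 * s * v)"
      using s \<sigma> by (intro mult_strict_left_mono) auto
    moreover have "\<sigma>\<^sup>2 / (2 * s) * (4 * s * v) = 2 * (\<sigma>\<^sup>2 * v)" using s by simp
    ultimately show ?thesis unfolding gv by (simp add: mult_ac)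
  qed
  show ?thesis using 1 2 by blast
qed

lemma continuous_on_R: "continuous_on {0..1} (R \<mu> \<sigma>)"
proof -
  have R0: "(R \<mu> \<sigma> \<longlongrightarrow> R \<mu> \<sigma> 0) (at 0 within {0..1})"
  proof -
    have "filterlim (\<lambda>\<theta>. \<sigma> * sqrt \<theta>) (at_right 0) (at_right 0)"
      unfolding filterlim_at
    proof
      have "((\<lambda>\<theta>. \<sigma> * sqrt \<theta>) \<longlongrightarrow> \<sigma> * sqrt 0) (at_right 0)" by (intro tendsto_intros)
      then show "((\<lambda>\<theta>. \<sigma> * sqrt \<theta>) \<longlongrightarrow> 0) (at_right 0)" by simp
      show "\<forall>\<^sub>F \<theta> in at_right 0. \<sigma> * sqrt \<theta> \<in> {0<..} \<and> \<sigma> * sqrt \<theta> \<noteq> 0"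
        using eventually_at_right_less[of 0] by eventually_elim (use \<sigma> in auto)
    qed
    from filterlim_compose[OF tendsto_path_profit_0[OF rate_pos] this]
    have "((\<lambda>\<theta>. path_profit rate (\<sigma> * sqrt \<theta>)) \<longlongrightarrow> 1) (at_right 0)" .
    then have "(gbar \<mu> \<sigma> \<longlongrightarrow> 1) (at_right 0)"
    proof (rule Lim_transform_eventually)
      show "\<forall>\<^sub>F \<theta> in at_right 0. path_profit rate (\<sigma> * sqrt \<theta>) = gbar \<mu> \<sigma> \<theta>"
        using eventually_at_right_less[of 0] by eventually_elim (simp add: gbar_eq_path_profit \<sigma>)
    qed
    then have "((\<lambda>\<theta>. \<theta> + (1 - \<theta>) * gbar \<mu> \<sigma> \<theta>) \<longlongrightarrow> 0 + (1 - 0) * 1) (at_right 0)"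
      by (intro tendsto_intros)
    then show ?thesis
      by (simp add: R_def[abs_def] gbar_0 at_within_Icc_at_right)
  qed
  show ?thesis
    unfolding continuous_on_def
  proof
    fix \<theta> :: real assume "\<theta> \<in> {0..1}"
    then consider "\<theta> = 0" | "0 < \<theta>" by force
    then show "(R \<mu> \<sigma> \<longlongrightarrow> R \<mu> \<sigma> \<theta>) (at \<theta> within {0..1})"
    proof cases
      case 1
      then show ?thesis using R0 by simp
    next
      case 2
      then show ?thesis
        using DERIV_isCont[OF DERIV_R[OF 2]] continuous_at_imp_continuous_at_within continuous_within by blast
    qed
  qed
qed

lemma first_order_condition_unique:
  assumes "0 < a" "a < 1" "first_order_condition \<mu> \<sigma> a"
    and "0 < b" "b < 1" "first_order_condition \<mu> \<sigma> b"
  shows "a = b"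
proof -
  obtain D where D: "\<And>x. 0 < x \<Longrightarrow> x < 1 \<Longrightarrow> (R_slope has_real_derivative D x) (at x)"
      "\<And>x. 0 < x \<Longrightarrow> x < 1 \<Longrightarrow> R_slope x = 0 \<Longrightarrow> D x < 0"
    using R_slope_falls_at_zero by metis
  have no: False if "0 < a" "a < b" "b < 1" "R_slope a = 0" "R_slope b = 0" for a b
  proof (rule at_most_one_falling_zero[OF _ _ that(2,4,5)])
    fix x assume "a \<le> x" "x \<le> b"
    then have x: "0 < x" "x < 1" using that by simp_all
    show "(R_slope has_real_derivative D x) (at x)" by (rule D(1)[OF x])
    show "R_slope x = 0 \<Longrightarrow> D x < 0" by (rule D(2)[OF x])
  qed
  have "R_slope a = 0" "R_slope b = 0"
    using first_order_condition_iff[OF assms(1,2)] first_order_condition_iff[OF assms(4,5)] assms(3,6)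
    by blast+
  then have "\<not> a < b" "\<not> b < a"
    using no[OF assms(1) _ assms(5)] no[OF assms(4) _ assms(2)] by blast+
  then show ?thesis by linarith
qed

text \<open>The objective is 1 at both ends of the interval and larger inside.\<close>

lemma ex_interior_maximum:
  obtains \<theta> where "0 < \<theta>" "\<theta> < 1" "first_order_condition \<mu> \<sigma> \<theta>" "\<And>y. y \<in> {0..1} \<Longrightarrow> R \<mu> \<sigma> y \<le> R \<mu> \<sigma> \<theta>"
proof -
  obtain \<theta> where t: "\<theta> \<in> {0..1}" and max: "\<And>y. y \<in> {0..1} \<Longrightarrow> R \<mu> \<sigma> y \<le> R \<mu> \<sigma> \<theta>"
    using continuous_attains_sup[OF compact_Icc _ continuous_on_R] by force
  have "1 < R \<mu> \<sigma> (1 / 2)" using gbar_gt_1[of "1 / 2"] by (simp add: R_def)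
  then have "1 < R \<mu> \<sigma> \<theta>" using max[of "1 / 2"] by simp
  then have ne: "0 < \<theta>" "\<theta> < 1" using t by (auto simp: R_def gbar_0 order_less_le)
  have "R_slope \<theta> = 0"
  proof (rule DERIV_local_max[OF DERIV_R[OF ne(1)]])
    show "0 < min \<theta> (1 - \<theta>)" using ne by simp
    show "\<forall>y. \<bar>\<theta> - y\<bar> < min \<theta> (1 - \<theta>) \<longrightarrow> R \<mu> \<sigma> y \<le> R \<mu> \<sigma> \<theta>"
    proof (intro allI impI)
      fix y assume "\<bar>\<theta> - y\<bar> < min \<theta> (1 - \<theta>)"
      then have "y \<in> {0..1}" by (auto simp: abs_less_iff)
      then show "R \<mu> \<sigma> y \<le> R \<mu> \<sigma> \<theta>" by (rule max)
    qed
  qed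
  then show thesis
    using ne max by (intro that) (auto simp: first_order_condition_iff)
qed

end

theorem proposition4:
  fixes \<mu> \<sigma> :: real
  assumes "\<mu> > 0" and "\<sigma> > 0"
  shows "(\<exists>\<theta>. 0 < \<theta> \<and> \<theta> < 1 \<and> first_order_condition \<mu> \<sigma> \<theta>) \<and>
    (\<exists>\<theta>\<^sub>0. 0 < \<theta>\<^sub>0 \<and> \<theta>\<^sub>0 < 1 \<and> first_order_condition \<mu> \<sigma> \<theta>\<^sub>0 \<and>
       (\<forall>\<theta>. 0 < \<theta> \<and> \<theta> < 1 \<and> first_order_condition \<mu> \<sigma> \<theta> \<longrightarrow> \<theta>\<^sub>0 \<le> \<theta>) \<and>
       local_maximum_on {0..1} (R \<mu> \<sigma>) \<theta>\<^sub>0) \<and>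
    (concave_on {0..1} (gbar \<mu> \<sigma>) \<longrightarrow>
       (\<exists>!\<theta>. 0 < \<theta> \<and> \<theta> < 1 \<and> first_order_condition \<mu> \<sigma> \<theta>))"
proof -
  from ex_interior_maximum[OF assms] obtain t where t: "0 < t" "t < 1" "first_order_condition \<mu> \<sigma> t"
    and max: "\<And>y. y \<in> {0..1} \<Longrightarrow> R \<mu> \<sigma> y \<le> R \<mu> \<sigma> t" by blast
  have unique: "\<theta> = t" if "0 < \<theta>" "\<theta> < 1" "first_order_condition \<mu> \<sigma> \<theta>" for \<theta>
    using first_order_condition_unique[OF assms that t] .
  have "\<forall>\<^sub>F y in at t within {0..1}. y \<in> {0..1}" by (simp add: eventually_at_filter)
  then have "\<forall>\<^sub>F y in at t within {0..1}. R \<mu> \<sigma> y \<le> R \<mu> \<sigma> t"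
    by eventually_elim (rule max)
  then have "local_maximum_on {0..1} (R \<mu> \<sigma>) t"
    using t by (simp add: local_maximum_on_def)
  moreover have "t \<le> \<theta>" if "0 < \<theta> \<and> \<theta> < 1 \<and> first_order_condition \<mu> \<sigma> \<theta>" for \<theta>
    by (rule eq_refl[OF sym], rule unique) (use that in blast)+
  moreover have "\<exists>!\<theta>. 0 < \<theta> \<and> \<theta> < 1 \<and> first_order_condition \<mu> \<sigma> \<theta>"
  proof (rule ex1I[of _ t])
    show "0 < t \<and> t < 1 \<and> first_order_condition \<mu> \<sigma> t" using t by blast
    show "\<theta> = t" if "0 < \<theta> \<and> \<theta> < 1 \<and> first_order_condition \<mu> \<sigma> \<theta>" for \<theta>
      by (rule unique) (use that in blast)+
  qed
  ultimately show ?thesis using t by (intro conjI exI[of _ t] impI allI)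
qed

end
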